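(* Let $E$ be an $F$-space over $\mathbb{K}$ ($\mathbb{K}=\mathbb{R}$ or $\mathbb{C}$) and let $W$ be a vector subspace of $E$ (not necessarily closed) that contains a non-minimal closed subspace of $E$. Then the following conditions are equivalent: (1) $E\setminus W$ is spaceable; (2) there exist a closed subspace $\mathcal{S}$ of $\ell_\infty$ with $c_0\subseteq\mathcal{S}$ and an $\mathcal{S}$-independent sequence $(x_n)_{n=1}^\infty$ of elements of $E$ such that $E\setminus W$ is $[(x_n)_{n=1}^\infty,\mathcal{S}]$-lineable; (3) $E\setminus W$ is $(n,\mathfrak{c})$-spaceable for each $n\in\mathbb{N}$.
   Context: All vector spaces are over $\mathbb{K}=\mathbb{R}$ or $\mathbb{C}$; "subspace" means vector subspace; $\mathbb{N}$ is the set of positive integers; $\mathfrak{c}=\mathrm{card}(\mathbb{R})$; $\dim$ denotes algebraic (Hamel) dimension. An $F$-space is a topological vector space whose topology is induced by a complete translation-invariant metric (no local convexity is assumed). The spaces $c_0\subseteq\ell_\infty\subseteq\mathbb{K}^{\mathbb{N}}$ are the usual spaces of null and bounded scalar sequences, and "closed subspace of $\ell_\infty$" refers to the supremum norm. A Hausdorff topological vector space is minimal if it admits no strictly weaker Hausdorff vector topology; it is non-minimal otherwise. A closed subspace of $E$ is called (non-)minimal if it is so with the topology induced from $E$. Let $A$ be a subset of a topological vector space $E$. $A$ is spaceable if $A\cup\{0\}$ contains an infinite-dimensional closed subspace of $E$. For a cardinal $\alpha$, $A$ is $\alpha$-lineable if there is a subspace $F_\alpha$ of $E$ with $\dim(F_\alpha)=\alpha$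 and $F_\alpha\setminus\{0\}\subset A$. For cardinals $\alpha\le\beta\le\dim(E)$, $A$ is $(\alpha,\beta)$-spaceable if $A$ is $\alpha$-lineable and for every subspace $F_\alpha\subset E$ with $F_\alpha\subset A\cup\{0\}$ and $\dim(F_\alpha)=\alpha$ there is a closed subspace $F_\beta\subset E$ with $\dim(F_\beta)=\beta$ and $F_\alpha\subset F_\beta\subset A\cup\{0\}$. Let $\mathcal{S}\neq\{0\}$ be a subspace of $\mathbb{K}^{\mathbb{N}}$. A sequence $(u_n)_{n=1}^\infty$ in a topological vector space $E$ is $\mathcal{S}$-independent if, whenever $(c_n)_{n=1}^\infty\in\mathcal{S}$ satisfies $\sum_{n=1}^\infty c_nu_n=0$ (convergent series), one has $c_n=0$ for all $n$. A subset $A$ of a Hausdorff topological vector space $E$ is $[(u_n)_{n=1}^\infty,\mathcal{S}]$-lineable (in $E$) if for each $(c_n)_{n=1}^\infty\in\mathcal{S}$ the series $\sum_{n=1}^\infty c_nu_n$ converges in $E$ to a vector in $A\cup\{0\}$. *)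

theory Defs
  imports "HOL-Analysis.Analysis" "HOL-Library.Function_Algebras" "HOL-Library.Equipollence"
begin

text \<open>
  The ground field is either \<^typ>\<open>real\<close> or \<^typ>\<open>complex\<close>; the definitions are uniform in
  the scalar type and take the scalar multiplication \<open>smul\<close> as a parameter, so that
  \<open>module.subspace smul\<close>, \<open>module.span smul\<close> and \<open>module.dependent smul\<close> are the
  notions over that field. Topologies are values of type \<open>'e topology\<close>, because minimality
  compares different vector topologies on the same, possibly proper, subspace.
\<close>

definition tvs :: "('k::real_normed_field \<Rightarrow> 'e::ab_group_add \<Rightarrow> 'e) \<Rightarrow> 'e topology \<Rightarrow> bool"
  where "tvs smul X \<longleftrightarrow>
    vector_space smul \<and> module.subspace smul (topspace X) \<and>
    continuous_map (prod_topology X X) X (\<lambda>(x, y). x + y) \<and>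
    continuous_map (prod_topology euclidean X) X (\<lambda>(a, x). smul a x)"

definition F_space :: "('k::real_normed_field \<Rightarrow> 'e::ab_group_add \<Rightarrow> 'e) \<Rightarrow> 'e topology \<Rightarrow> bool"
  where "F_space smul X \<longleftrightarrow>
    tvs smul X \<and> topspace X = UNIV \<and>
    (\<exists>d. Metric_space UNIV d \<and> Metric_space.mtopology UNIV d = X \<and>
      Metric_space.mcomplete UNIV d \<and> (\<forall>x y z. d (x + z) (y + z) = d x y))"

text \<open>To be used for Hausdorff topological vector spaces \<open>X\<close> only.\<close>

definition minimal_tvs :: "('k::real_normed_field \<Rightarrow> 'e::ab_group_add \<Rightarrow> 'e) \<Rightarrow> 'e topology \<Rightarrow> bool"
  where "minimal_tvs smul X \<longleftrightarrow>
    \<not> (\<exists>Y. topspace Y = topspace X \<and> tvs smul Y \<and> Hausdorff_space Y \<and>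
        (\<forall>U. openin Y U \<longrightarrow> openin X U) \<and> Y \<noteq> X)"

definition closed_subspace ::
    "('k::real_normed_field \<Rightarrow> 'e::ab_group_add \<Rightarrow> 'e) \<Rightarrow> 'e topology \<Rightarrow> 'e set \<Rightarrow> bool"
  where "closed_subspace smul X F \<longleftrightarrow> module.subspace smul F \<and> closedin X F"

text \<open>
  The algebraic dimension of the subspace \<open>F\<close> is the cardinality of the set \<open>\<alpha>\<close>:
  cardinals are given by representing sets.
\<close>

definition has_hamel_dim ::
    "('k::real_normed_field \<Rightarrow> 'e::ab_group_add \<Rightarrow> 'e) \<Rightarrow> 'e set \<Rightarrow> 'c set \<Rightarrow> bool"
  where "has_hamel_dim smul F \<alpha> \<longleftrightarrow>
    (\<exists>B. \<not> module.dependent smul B \<and> module.span smul B = F \<and> B \<approx> \<alpha>)"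

definition infinite_dimensional ::
    "('k::real_normed_field \<Rightarrow> 'e::ab_group_add \<Rightarrow> 'e) \<Rightarrow> 'e set \<Rightarrow> bool"
  where "infinite_dimensional smul F \<longleftrightarrow>
    (\<exists>B. \<not> module.dependent smul B \<and> module.span smul B = F \<and> infinite B)"

definition spaceable ::
    "('k::real_normed_field \<Rightarrow> 'e::ab_group_add \<Rightarrow> 'e) \<Rightarrow> 'e topology \<Rightarrow> 'e set \<Rightarrow> bool"
  where "spaceable smul X A \<longleftrightarrow>
    (\<exists>F. closed_subspace smul X F \<and> infinite_dimensional smul F \<and> F \<subseteq> A \<union> {0})"

definition lineable ::
    "('k::real_normed_field \<Rightarrow> 'e::ab_group_add \<Rightarrow> 'e) \<Rightarrow> 'c set \<Rightarrow> 'e set \<Rightarrow> bool"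
  where "lineable smul \<alpha> A \<longleftrightarrow>
    (\<exists>F. module.subspace smul F \<and> has_hamel_dim smul F \<alpha> \<and> F - {0} \<subseteq> A)"

text \<open>
  The usual proviso \<open>\<alpha> \<le> \<beta> \<le> dim E\<close> is implied: by lineability some \<open>F\<close> exists,
  and then \<open>F \<subseteq> G \<subseteq> E\<close>.
\<close>

definition pair_spaceable ::
    "('k::real_normed_field \<Rightarrow> 'e::ab_group_add \<Rightarrow> 'e) \<Rightarrow> 'e topology \<Rightarrow>
      'c set \<Rightarrow> 'd set \<Rightarrow> 'e set \<Rightarrow> bool"
  where "pair_spaceable smul X \<alpha> \<beta> A \<longleftrightarrow>
    lineable smul \<alpha> A \<and>
    (\<forall>F. module.subspace smul F \<and> F \<subseteq> A \<union> {0} \<and> has_hamel_dim smul F \<alpha> \<longrightarrow>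
      (\<exists>G. closed_subspace smul X G \<and> has_hamel_dim smul G \<beta> \<and> F \<subseteq> G \<and> G \<subseteq> A \<union> {0}))"

text \<open>Sequences indexed by the positive integers are rendered as functions on \<^typ>\<open>nat\<close>,
  the \<open>n\<close>-th term being the value at \<open>n - 1\<close>.\<close>

definition seq_scale :: "'k::real_normed_field \<Rightarrow> (nat \<Rightarrow> 'k) \<Rightarrow> nat \<Rightarrow> 'k"
  where "seq_scale a c = (\<lambda>n. a * c n)"

definition c_null :: "(nat \<Rightarrow> 'k::real_normed_field) set"
  where "c_null = {c. c \<longlonglongrightarrow> 0}"

definition l_infty :: "(nat \<Rightarrow> 'k::real_normed_field) metric"
  where "l_infty = funspace UNIV euclidean_metric"

lemma mspace_l_infty: "mspace l_infty = {c. bounded (range c)}"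
  by (auto simp: l_infty_def Met_TC.fspace_def extensional_def)

lemma mdist_l_infty:
  assumes "bounded (range c)" "bounded (range e)"
  shows "mdist l_infty c e = (SUP n. norm (c n - e n))"
  using assms
  by (simp add: l_infty_def Met_TC.fdist_def Met_TC.fspace_def extensional_def dist_norm)

definition series_converges_to ::
    "('k::real_normed_field \<Rightarrow> 'e::ab_group_add \<Rightarrow> 'e) \<Rightarrow> 'e topology \<Rightarrow>
      (nat \<Rightarrow> 'k) \<Rightarrow> (nat \<Rightarrow> 'e) \<Rightarrow> 'e \<Rightarrow> bool"
  where "series_converges_to smul X c u l \<longleftrightarrow>
    limitin X (\<lambda>N. \<Sum>n<N. smul (c n) (u n)) l sequentially"

definition S_independent ::
    "('k::real_normed_field \<Rightarrow> 'e::ab_group_add \<Rightarrow> 'e) \<Rightarrow> 'e topology \<Rightarrow>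
      (nat \<Rightarrow> 'k) set \<Rightarrow> (nat \<Rightarrow> 'e) \<Rightarrow> bool"
  where "S_independent smul X S u \<longleftrightarrow>
    (\<forall>c\<in>S. series_converges_to smul X c u 0 \<longrightarrow> (\<forall>n. c n = 0))"

definition seq_lineable ::
    "('k::real_normed_field \<Rightarrow> 'e::ab_group_add \<Rightarrow> 'e) \<Rightarrow> 'e topology \<Rightarrow>
      (nat \<Rightarrow> 'e) \<Rightarrow> (nat \<Rightarrow> 'k) set \<Rightarrow> 'e set \<Rightarrow> bool"
  where "seq_lineable smul X u S A \<longleftrightarrow>
    (\<forall>c\<in>S. \<exists>l \<in> A \<union> {0}. series_converges_to smul X c u l)"

end

theory Submission
  imports Defs "HOL-Computational_Algebra.Polynomial"
begin

text \<open>
  Condition (2) is used only with \<open>S = c_null\<close>. From (1), rapidly decreasing multiples of a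
  linearly independent sequence in the given closed subspace satisfy it. From (3) with \<open>n = 1\<close>
  one gets (1) at once.

  For (2) to (3), let \<open>M \<subseteq> W\<close> be closed and non-minimal. A closed graph argument turns a
  strictly weaker Hausdorff vector topology on \<open>M\<close> into a sequence \<open>y n\<close> in \<open>M\<close> that tends to zero
  in the weaker topology, while finite combinations with some coefficient of modulus one stay away
  from zero in the topology of \<open>M\<close>. Perturbing \<open>y n\<close> by a small multiple of \<open>x n\<close> gives a
  sequence whose closed span meets \<open>W\<close> only in zero: an element of the closed span is, modulo \<open>M\<close>,
  a combination of the \<open>x n\<close> with null coefficients, and it vanishes if its coefficients do. A given
  finite-dimensional subspace \<open>F\<close> is first added to \<open>W\<close>, after thinning out \<open>x\<close>, and finally to the
  closed span.
\<close>

text \<open>Without local convexity there may be no continuous functionals to serve as coordinates.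
  Their role is taken by lower bounds: if combinations with a coefficient of modulus one stay away
  from zero, then small combinations have small coefficients, and the coefficients of a convergent
  sequence of combinations converge uniformly. Uniform limits of finitely supported sequences are
  null sequences, which is why \<open>c_null\<close> is the right coefficient space. Such a bound
  does not settle the matter, since combinations whose coefficients tend uniformly to zero could
  still converge to a nonzero vector. The sequence in \<open>M\<close> must exclude this too, and
  both properties come from separating the head of a combination from its tail. The tool for the
  separation is the weak closure \<open>V r\<close> of a ball. Being weakly closed, it is
  insensitive to weakly small tails; not being a weak neighbourhood of zero for some
  \<open>r\<close>, it leaves weakly small vectors outside. The subspace \<open>W\<close> is never
  assumed closed: limits are taken only in \<open>M\<close>, and \<open>W\<close> enters through the
  independence of the series modulo \<open>W\<close>.\<close>

section \<open>F-normed spaces\<close>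

text \<open>\<open>q\<close> is an F-norm: \<open>q_scale_le\<close> and
  \<open>q_scale_small\<close> replace homogeneity. The class \<open>heine_borel\<close> makes the
  scalar field complete and its unit disc compact, which is needed for limits of coefficients and
  for finite nets.\<close>

locale fnormed_space = vector_space scale
  for scale :: "'k::{real_normed_field,heine_borel} \<Rightarrow> 'e::ab_group_add \<Rightarrow> 'e" (infixr "\<odot>" 75) +
  fixes q :: "'e \<Rightarrow> real"
  assumes q_zero [simp]: "q 0 = 0"
    and q_eq_0D: "q x = 0 \<Longrightarrow> x = 0"
    and q_add: "q (x + y) \<le> q x + q y"
    and q_scale_le: "norm c \<le> 1 \<Longrightarrow> q (c \<odot> x) \<le> q x"
    and q_scale_small: "0 < e \<Longrightarrow> \<exists>d>0. \<forall>c. norm c < d \<longrightarrow> q (c \<odot> x) < e"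
    and q_complete: "(\<And>e. 0 < e \<Longrightarrow> \<exists>N. \<forall>m\<ge>N. \<forall>n\<ge>N. q (s m - s n) < e)
      \<Longrightarrow> \<exists>l. (\<lambda>n::nat. q (s n - l)) \<longlonglongrightarrow> 0"
begin

lemma q_uminus [simp]: "q (- x) = q x"
proof -
  have le: "q (- z) \<le> q z" for z
    using q_scale_le[of "-1" z] by simp
  show ?thesis using le[of x] le[of "- x"] by simp
qed

lemma q_nonneg [simp]: "0 \<le> q x"
  using q_add[of x "- x"] by simp

lemma q_diff: "q (x - y) \<le> q x + q y"
  using q_add[of x "- y"] by simp

lemma q_diff_commute: "q (x - y) = q (y - x)"
  using q_uminus[of "x - y"] by simp

lemma q_diff_triangle: "q (x - z) \<le> q (x - y) + q (y - z)"
  using q_add[of "x - y" "y - z"] by simp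

lemma q_unit_scale:
  assumes "norm c = 1"
  shows "q (c \<odot> x) = q x"
proof -
  have "c \<noteq> 0" using assms by auto
  then have "x = inverse c \<odot> (c \<odot> x)" by simp
  moreover have "norm (inverse c) \<le> 1" using assms by (simp add: norm_inverse)
  ultimately have "q x \<le> q (c \<odot> x)" by (metis q_scale_le)
  then show ?thesis using q_scale_le[of c x] assms by simp
qed

lemma q_of_nat: "q (of_nat n \<odot> x) \<le> real n * q x"
proof (induction n)
  case (Suc n)
  have "of_nat (Suc n) \<odot> x = x + of_nat n \<odot> x"
    by (simp add: scale_left_distrib)
  then show ?case using q_add[of x "of_nat n \<odot> x"] Suc by (simp add: algebra_simps)
qed simp

text \<open>In place of homogeneity: \<open>c\<close> is \<open>n\<close> times a scalar of modulus
  at most one, and subadditivity pays a factor \<open>n\<close> for the integer.\<close>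

lemma q_scale_bound:
  assumes "norm c \<le> real n"
  shows "q (c \<odot> x) \<le> real n * q x"
proof (cases "n = 0")
  case False
  have "norm (c / of_nat n) \<le> 1"
    using assms False by (simp add: norm_divide)
  then have "q ((c / of_nat n) \<odot> (of_nat n \<odot> x)) \<le> q (of_nat n \<odot> x)"
    by (rule q_scale_le)
  then show ?thesis using q_of_nat[of n x] False by simp
qed (use assms in auto)

lemma q_sum: "q (\<Sum>i\<in>I. f i) \<le> (\<Sum>i\<in>I. q (f i))"
proof (induction I rule: infinite_finite_induct)
  case (insert i I)
  then show ?case using q_add[of "f i" "sum f I"] by simp
qed auto

abbreviation qlim :: "(nat \<Rightarrow> 'e) \<Rightarrow> 'e \<Rightarrow> bool"
  where "qlim s l \<equiv> (\<lambda>n. q (s n - l)) \<longlonglongrightarrow> 0"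

lemma qlim_iff: "qlim s l \<longleftrightarrow> (\<forall>e>0. \<exists>N. \<forall>n\<ge>N. q (s n - l) < e)"
  by (simp add: LIMSEQ_iff)

lemma qlim_squeeze:
  assumes "\<And>n. q (s n - l) \<le> f n" "f \<longlonglongrightarrow> 0"
  shows "qlim s l"
  by (rule tendsto_sandwich[of "\<lambda>_. 0" _ _ f]) (use assms in auto)

lemma qlim_add:
  assumes "qlim s l" "qlim t m"
  shows "qlim (\<lambda>n. s n + t n) (l + m)"
proof (rule qlim_squeeze)
  show "q (s n + t n - (l + m)) \<le> q (s n - l) + q (t n - m)" for n
    using q_add[of "s n - l" "t n - m"] by (simp add: algebra_simps)
  show "(\<lambda>n. q (s n - l) + q (t n - m)) \<longlonglongrightarrow> 0"
    using tendsto_add[OF assms] by simp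
qed

lemma qlim_scale:
  assumes "qlim s l"
  shows "qlim (\<lambda>n. c \<odot> s n) (c \<odot> l)"
proof -
  obtain k :: nat where k: "norm c \<le> real k"
    using real_arch_simple by blast
  show ?thesis
  proof (rule qlim_squeeze)
    show "q (c \<odot> s n - c \<odot> l) \<le> real k * q (s n - l)" for n
      using q_scale_bound[OF k, of "s n - l"] by (simp add: scale_right_diff_distrib)
    show "(\<lambda>n. real k * q (s n - l)) \<longlonglongrightarrow> 0"
      using tendsto_mult_left[OF assms, of "real k"] by simp
  qed
qed

lemma qlim_diff:
  assumes "qlim s l" "qlim t m"
  shows "qlim (\<lambda>n. s n - t n) (l - m)"
  using qlim_add[OF assms(1) qlim_scale[OF assms(2), of "-1"]] by simp

lemma qlim_scalars:
  assumes "c \<longlonglongrightarrow> a"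
  shows "qlim (\<lambda>n. c n \<odot> x) (a \<odot> x)"
  unfolding qlim_iff
proof (intro allI impI)
  fix e :: real assume "0 < e"
  then obtain d where d: "d > 0" "\<And>c. norm c < d \<Longrightarrow> q (c \<odot> x) < e"
    using q_scale_small[of e x] by auto
  obtain N where N: "\<And>n. n \<ge> N \<Longrightarrow> norm (c n - a) < d"
    using assms d(1) unfolding LIMSEQ_iff by blast
  then show "\<exists>N. \<forall>n\<ge>N. q (c n \<odot> x - a \<odot> x) < e"
    using d(2) by (auto simp flip: scale_left_diff_distrib)
qed

lemma qlim_unique:
  assumes "qlim s l" "qlim s m"
  shows "l = m"
proof -
  have "(\<lambda>n. q (s n - l) + q (s n - m)) \<longlonglongrightarrow> 0"
    using tendsto_add[OF assms] by simp
  moreover have "q (l - m) \<le> q (s n - l) + q (s n - m)" for n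
    using q_diff_triangle[of l m "s n"] q_diff_commute by metis
  ultimately have "q (l - m) \<le> 0"
    by (intro LIMSEQ_le_const) auto
  then show ?thesis using q_eq_0D[of "l - m"] q_nonneg[of "l - m"] by auto
qed

lemma qlim_const [simp]: "qlim (\<lambda>_. l) l"
  by simp

lemma qlim_ex_if_summable:
  assumes "summable (\<lambda>n. q (u n))"
  shows "\<exists>l. qlim (\<lambda>n. \<Sum>i<n. u i) l"
proof (rule q_complete)
  fix e :: real assume "0 < e"
  then obtain N where N: "\<And>m n. m \<ge> N \<Longrightarrow> norm (sum (\<lambda>n. q (u n)) {m..<n}) < e"
    using assms unfolding summable_Cauchy by blast
  have *: "q ((\<Sum>i<m. u i) - (\<Sum>i<n. u i)) < e" if "N \<le> m" "m \<le> n" for m n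
  proof -
    have "(\<Sum>i<n. u i) - (\<Sum>i<m. u i) = sum u {m..<n}"
      using that by (simp add: lessThan_atLeast0 sum_diff_nat_ivl)
    then have "q ((\<Sum>i<n. u i) - (\<Sum>i<m. u i)) \<le> (\<Sum>i\<in>{m..<n}. q (u i))"
      by (simp add: q_sum)
    also have "\<dots> < e" using N[OF that(1), of n] by simp
    finally show ?thesis by (simp add: q_diff_commute)
  qed
  show "\<exists>N. \<forall>m\<ge>N. \<forall>n\<ge>N. q ((\<Sum>i<m. u i) - (\<Sum>i<n. u i)) < e"
  proof (intro exI allI impI)
    fix m n assume "N \<le> m" "N \<le> n"
    then show "q ((\<Sum>i<m. u i) - (\<Sum>i<n. u i)) < e"
      using *[of m n] *[of n m] q_diff_commute[of "sum u {..<m}" "sum u {..<n}"]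
      by (cases "m \<le> n") simp_all
  qed
qed

section \<open>Closures and closed subspaces\<close>

definition qcl :: "'e set \<Rightarrow> 'e set"
  where "qcl S = {x. \<forall>e>0. \<exists>s\<in>S. q (x - s) < e}"

definition qclosed :: "'e set \<Rightarrow> bool"
  where "qclosed S \<longleftrightarrow> qcl S \<subseteq> S"

lemma subset_qcl: "S \<subseteq> qcl S"
  by (auto simp: qcl_def intro!: bexI)

lemma qcl_mono: "S \<subseteq> T \<Longrightarrow> qcl S \<subseteq> qcl T"
  unfolding qcl_def by blast

lemma in_qcl_sequence:
  "x \<in> qcl S \<longleftrightarrow> (\<exists>s. (\<forall>n. s n \<in> S) \<and> qlim s x)"
proof
  assume x: "x \<in> qcl S"
  have "\<forall>n. \<exists>s\<in>S. q (x - s) < inverse (real (Suc n))"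
    using x by (simp add: qcl_def)
  then obtain s where s: "\<And>n. s n \<in> S" "\<And>n. q (x - s n) < inverse (real (Suc n))"
    by metis
  have "qlim s x"
  proof (rule qlim_squeeze)
    show "q (s n - x) \<le> inverse (real (Suc n))" for n
      using s(2)[of n] by (simp add: q_diff_commute)
  qed (rule LIMSEQ_inverse_real_of_nat)
  then show "\<exists>s. (\<forall>n. s n \<in> S) \<and> qlim s x" using s(1) by blast
next
  assume "\<exists>s. (\<forall>n. s n \<in> S) \<and> qlim s x"
  then obtain s where s: "\<And>n. s n \<in> S" "qlim s x" by blast
  show "x \<in> qcl S"
    unfolding qcl_def
  proof (intro CollectI allI impI)
    fix e :: real assume "e > 0"
    then obtain n where "q (s n - x) < e" using s(2) unfolding qlim_iff by blast
    then show "\<exists>s\<in>S. q (x - s) < e" 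
      using s(1)[of n] q_diff_commute[of x "s n"] by (intro bexI[of _ "s n"]) simp_all
  qed
qed

lemma qclE:
  assumes "x \<in> qcl S"
  obtains s where "\<And>n. s n \<in> S" "qlim s x"
  using assms in_qcl_sequence by blast

lemma qclI: "\<lbrakk>\<And>n. s n \<in> S; qlim s x\<rbrakk> \<Longrightarrow> x \<in> qcl S"
  using in_qcl_sequence by blast

lemma qclosed_limit: "\<lbrakk>qclosed S; \<And>n. s n \<in> S; qlim s x\<rbrakk> \<Longrightarrow> x \<in> S"
  unfolding qclosed_def using in_qcl_sequence by blast

lemma qclosedI: "(\<And>s x. \<lbrakk>\<And>n. s n \<in> S; qlim s x\<rbrakk> \<Longrightarrow> x \<in> S) \<Longrightarrow> qclosed S"
  unfolding qclosed_def using in_qcl_sequence by blast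

lemma qclosed_qcl: "qclosed (qcl S)"
  unfolding qclosed_def
proof
  fix x assume x: "x \<in> qcl (qcl S)"
  show "x \<in> qcl S"
    unfolding qcl_def
  proof (intro CollectI allI impI)
    fix e :: real assume e: "0 < e"
    then obtain y where y: "y \<in> qcl S" "q (x - y) < e / 2"
      using x unfolding qcl_def[of "qcl S"] by (auto dest!: spec[of _ "e/2"])
    then obtain s where "s \<in> S" "q (y - s) < e / 2"
      using e unfolding qcl_def by (auto dest!: spec[of _ "e/2"])
    with y show "\<exists>s\<in>S. q (x - s) < e"
      using q_diff_triangle[of x s y] by (intro bexI[of _ s]) auto
  qed
qed

lemma subspace_qcl:
  assumes "subspace S"
  shows "subspace (qcl S)"
proof (rule subspaceI)
  show "0 \<in> qcl S" using subset_qcl subspace_0[OF assms] by blast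
  show "x + y \<in> qcl S" if "x \<in> qcl S" "y \<in> qcl S" for x y
  proof -
    obtain s where s: "\<And>n. s n \<in> S" "qlim s x" using \<open>x \<in> qcl S\<close> by (rule qclE) blast
    obtain t where t: "\<And>n. t n \<in> S" "qlim t y" using \<open>y \<in> qcl S\<close> by (rule qclE) blast
    show ?thesis
      by (rule qclI[of "\<lambda>n. s n + t n"])
        (use s t in \<open>auto intro: qlim_add subspace_add[OF assms]\<close>)
  qed
  show "c \<odot> x \<in> qcl S" if "x \<in> qcl S" for c x
  proof -
    obtain s where s: "\<And>n. s n \<in> S" "qlim s x" using \<open>x \<in> qcl S\<close> by (rule qclE) blast
    show ?thesis
      by (rule qclI[of "\<lambda>n. c \<odot> s n"])
        (use s in \<open>auto intro: qlim_scale subspace_scale[OF assms]\<close>)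
  qed
qed

text \<open>Since \<open>H\<close> is closed, \<open>f\<close> has positive distance from it;
  factoring out the unimodular \<open>c\<close>, which \<open>q\<close> ignores, reduces every
  \<open>h + c \<odot> f\<close> to that distance.\<close>

lemma dist_to_subspace:
  assumes "subspace H" "qclosed H" "f \<notin> H"
  obtains d where "d > 0" "\<And>h c. \<lbrakk>h \<in> H; norm c = 1\<rbrakk> \<Longrightarrow> d \<le> q (h + c \<odot> f)"
proof -
  have "f \<notin> qcl H" using assms unfolding qclosed_def by blast
  then obtain d where d: "d > 0" "\<And>h. h \<in> H \<Longrightarrow> d \<le> q (f - h)"
    unfolding qcl_def by force
  have "d \<le> q (h + c \<odot> f)" if "h \<in> H" "norm c = 1" for h c
  proof -
    have "c \<noteq> 0" using that by auto
    then have "h + c \<odot> f = c \<odot> (f - (- inverse c \<odot> h))"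
      by (simp add: scale_right_distrib add.commute)
    then have "q (h + c \<odot> f) = q (f - (- inverse c \<odot> h))"
      using q_unit_scale[OF that(2)] by simp
    then show ?thesis using d(2)[OF subspace_scale[OF assms(1) that(1), of "- inverse c"]] by simp
  qed
  with d(1) that show ?thesis by blast
qed

text \<open>An element of small size has small coordinates: otherwise dividing by a large coordinate
  contradicts the lower bound on elements with a coordinate of modulus one.\<close>

lemma coordinate_small:
  assumes d: "0 < d" "\<And>x c. P x c \<Longrightarrow> norm c = 1 \<Longrightarrow> d \<le> q x"
    and P: "\<And>x c. P x c \<Longrightarrow> norm c > 0 \<Longrightarrow> P (inverse c \<odot> x) 1"
    and e: "0 < e"
  shows "\<exists>h>0. \<forall>x c. P x c \<longrightarrow> q x < h \<longrightarrow> norm c < e"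
proof -
  \<comment> \<open>\<open>k\<close> bounds the modulus of \<open>inverse c\<close> as soon as
    \<open>norm c\<close> is at least \<open>e\<close>; dividing by \<open>c\<close> then costs a
    factor \<open>k\<close>, hence the radius \<open>d / real k\<close> below.\<close>
  obtain k :: nat where k: "inverse e \<le> real k"
    using real_arch_simple by blast
  moreover have "0 < inverse e" using e by simp
  ultimately have kpos: "0 < real k" by linarith
  have "norm c < e" if "P x c" "q x < d / real k" for x c
  proof (rule ccontr)
    assume "\<not> norm c < e"
    with e have c: "norm c \<ge> e" "norm c > 0" by auto
    have "norm (inverse c) \<le> real k"
      using le_imp_inverse_le[OF c(1) e] k by (simp add: norm_inverse)
    then have "q (inverse c \<odot> x) \<le> real k * q x" by (rule q_scale_bound)
    also have "\<dots> < d" using that(2) kpos by (simp add: field_simps)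
    finally show False using d(2)[OF P[OF that(1) c(2)]] by simp
  qed
  then show ?thesis using d(1) kpos by (intro exI[of _ "d / real k"]) auto
qed

text \<open>Outside the trivial case, a small element of the sum has a small coefficient at
  \<open>f\<close>. So the coefficients along a convergent sequence are Cauchy, and subtracting
  their limit times \<open>f\<close> leaves a limit of elements of \<open>H\<close>.\<close>

lemma qclosed_add_line:
  assumes H: "subspace H" "qclosed H"
  shows "qclosed {h + c \<odot> f |h c. h \<in> H}"
proof (cases "f \<in> H")
  case True
  have "h + c \<odot> f \<in> H" if "h \<in> H" for h c
    using True H(1) that by (simp add: subspace_add subspace_scale)
  moreover have "h = h + 0 \<odot> f" for h by simp
  ultimately have "{h + c \<odot> f |h c. h \<in> H} = H" by blast
  then show ?thesis using H by simp
next
  case False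
  obtain d where d: "d > 0" "\<And>h c. \<lbrakk>h \<in> H; norm c = 1\<rbrakk> \<Longrightarrow> d \<le> q (h + c \<odot> f)"
    using dist_to_subspace[OF H False] by blast
  have small: "\<exists>r>0. \<forall>x c. (\<exists>h\<in>H. x = h + c \<odot> f) \<longrightarrow> q x < r \<longrightarrow> norm c < e" if "e > 0" for e
  proof (rule coordinate_small[OF d(1) _ _ that])
    show "d \<le> q x" if "\<exists>h\<in>H. x = h + c \<odot> f" "norm c = 1" for x c
      using that d(2) by blast
    show "\<exists>h\<in>H. inverse c \<odot> x = h + 1 \<odot> f" if ex: "\<exists>h\<in>H. x = h + c \<odot> f" and "0 < norm c" for x c
    proof -
      obtain h where "h \<in> H" "x = h + c \<odot> f" using ex by blast
      then show ?thesis
        using \<open>0 < norm c\<close> subspace_scale[OF H(1)]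
        by (intro bexI[of _ "inverse c \<odot> h"]) (auto simp: scale_right_distrib)
    qed
  qed
  show ?thesis
  proof (rule qclosedI)
    fix s x assume s: "\<And>n. s n \<in> {h + c \<odot> f |h c. h \<in> H}" "qlim s x"
    then have "\<forall>n. \<exists>h c. s n = h + c \<odot> f \<and> h \<in> H" by blast
    then obtain h c where hc: "\<And>n. s n = h n + c n \<odot> f" "\<And>n. h n \<in> H" by metis
    have "Cauchy c"
      unfolding Cauchy_iff
    proof (intro allI impI)
      fix e :: real assume "e > 0"
      then obtain r where r: "r > 0"
        "\<And>x c. (\<exists>h\<in>H. x = h + c \<odot> f) \<Longrightarrow> q x < r \<Longrightarrow> norm c < e"
        using small by meson
      obtain N where N: "\<And>n. n \<ge> N \<Longrightarrow> q (s n - x) < r / 2"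
        using s(2) r(1) unfolding qlim_iff by (meson half_gt_zero)
      have "norm (c m - c n) < e" if "m \<ge> N" "n \<ge> N" for m n
      proof (rule r(2))
        show "\<exists>k\<in>H. s m - s n = k + (c m - c n) \<odot> f"
          using hc subspace_diff[OF H(1)]
          by (intro bexI[of _ "h m - h n"]) (auto simp: algebra_simps)
        show "q (s m - s n) < r"
          using q_diff_triangle[of "s m" "s n" x] N[OF that(1)] N[OF that(2)]
            q_diff_commute[of x "s n"] by linarith
      qed
      then show "\<exists>M. \<forall>m\<ge>M. \<forall>n\<ge>M. norm (c m - c n) < e" by blast
    qed
    then obtain a where a: "c \<longlonglongrightarrow> a"
      using Cauchy_convergent_iff convergent_def by blast
    have "qlim (\<lambda>n. s n - c n \<odot> f) (x - a \<odot> f)"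
      by (rule qlim_diff[OF s(2) qlim_scalars[OF a]])
    moreover have "s n - c n \<odot> f = h n" for n using hc by simp
    ultimately have "x - a \<odot> f \<in> H"
      using qclosed_limit[OF H(2), of h] hc(2) by simp
    then show "x \<in> {h + c \<odot> f |h c. h \<in> H}" 
      by (intro CollectI exI[of _ "x - a \<odot> f"] exI[of _ a]) simp
  qed
qed

lemma span_Un_insert_line:
  "span (G \<union> insert f B) = {h + c \<odot> f |h c. h \<in> span (G \<union> B)}"
proof -
  have "span (G \<union> insert f B) = {x. \<exists>k. x - k \<odot> f \<in> span (G \<union> B)}"
    by (simp add: span_insert)
  also have "\<dots> = {h + c \<odot> f |h c. h \<in> span (G \<union> B)}"
  proof (intro set_eqI iffI)
    fix x assume "x \<in> {x. \<exists>k. x - k \<odot> f \<in> span (G \<union> B)}"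
    then obtain k where "x - k \<odot> f \<in> span (G \<union> B)" by blast
    moreover have "x = (x - k \<odot> f) + k \<odot> f" by simp
    ultimately show "x \<in> {h + c \<odot> f |h c. h \<in> span (G \<union> B)}" by blast
  next
    fix x assume "x \<in> {h + c \<odot> f |h c. h \<in> span (G \<union> B)}"
    then obtain h c where "x = h + c \<odot> f" "h \<in> span (G \<union> B)" by blast
    then have "x - c \<odot> f \<in> span (G \<union> B)" by simp
    then show "x \<in> {x. \<exists>k. x - k \<odot> f \<in> span (G \<union> B)}" by blast
  qed
  finally show ?thesis .
qed

lemma qclosed_span_Un_finite:
  assumes G: "subspace G" "qclosed G" and "finite B"
  shows "qclosed (span (G \<union> B))"
  using \<open>finite B\<close>
proof (induction B rule: finite_induct)
  case empty
  then show ?case using G by (simp add: span_eq_iff[THEN iffD2])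
next
  case (insert f B)
  show ?case
    unfolding span_Un_insert_line by (rule qclosed_add_line[OF subspace_span insert.IH])
qed

lemma qclosed_zero: "qclosed {0}"
proof (rule qclosedI)
  fix s :: "nat \<Rightarrow> 'e" and x assume "\<And>n. s n \<in> {0}" "qlim s x"
  then show "x \<in> {0}" using q_eq_0D[of x] by (simp add: LIMSEQ_const_iff)
qed

lemma qclosed_span_finite: "finite B \<Longrightarrow> qclosed (span B)"
  using qclosed_span_Un_finite[OF subspace_single_0 qclosed_zero, of B] by simp

end

section \<open>Independence over the null sequences\<close>

lemma summable_le_halving:
  fixes a D :: "nat \<Rightarrow> real"
  assumes "\<And>n. 0 \<le> a n" "\<And>n. a n \<le> D n" "\<And>n. D (Suc n) \<le> D n / 2"
  shows "summable a" and "(\<Sum>i\<in>{n..<m}. a i) \<le> 2 * D n"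
proof -
  have Dnn: "0 \<le> D n" for n using assms(1,2) order_trans by blast
  show "summable a"
  proof (rule summable_comparison_test[OF _ summable_ratio_test[of "1/2" 0 D]])
    show "\<exists>N. \<forall>n\<ge>N. norm (a n) \<le> D n" using assms by simp
    show "norm (D (Suc n)) \<le> 1 / 2 * norm (D n)" for n
      using Dnn assms(3)[of n] by simp
  qed simp
  \<comment> \<open>Subtracting the remainder \<open>2 * D (n + k)\<close> closes the induction: its
    decrease in one step pays for the new term.\<close>
  have "(\<Sum>i\<in>{n..<n + k}. a i) \<le> 2 * D n - 2 * D (n + k)" for k
  proof (induction k)
    case (Suc k)
    then show ?case using assms(2)[of "n+k"] assms(3)[of "n+k"] by simp
  qed simp
  from this[of "m - n"] Dnn[of n] Dnn[of m] show "(\<Sum>i\<in>{n..<m}. a i) \<le> 2 * D n"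
    by (cases "n \<le> m") auto
qed

text \<open>All but finitely many terms are smaller than \<open>norm (c m)\<close>, so the supremum
  is a maximum. This fails for bounded sequences in general.\<close>

lemma c_null_max:
  assumes "c \<in> c_null" "c m \<noteq> 0"
  obtains n where "c n \<noteq> 0" "\<And>i. norm (c i) \<le> norm (c n)"
proof -
  have "c \<longlonglongrightarrow> 0" using assms by (simp add: c_null_def)
  then obtain N where N: "\<And>i. i \<ge> N \<Longrightarrow> norm (c i) < norm (c m)"
    using assms(2) unfolding LIMSEQ_iff by (metis diff_zero zero_less_norm_iff)
  define S where "S = (\<lambda>i. norm (c i)) ` {..N + m}"
  have "Max S \<in> S" by (rule Max_in) (auto simp: S_def)
  then obtain n where n: "norm (c n) = Max S" by (metis S_def imageE)
  have le: "norm (c i) \<le> norm (c n)" if "i \<le> N + m" for i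
    unfolding n by (rule Max_ge) (use that in \<open>auto simp: S_def\<close>)
  have "norm (c i) \<le> norm (c n)" for i
    using le[of i] le[of m] N[of i] by (cases "i \<le> N + m") auto
  moreover have "c n \<noteq> 0" using le[of m] assms(2) by auto
  ultimately show ?thesis using that by blast
qed

lemma c_null_bounded:
  assumes "c \<in> c_null"
  obtains k :: nat where "\<And>i. norm (c i) \<le> real k"
proof -
  have "Bseq c" using assms convergent_imp_Bseq by (auto simp: c_null_def convergent_def)
  then obtain K where "\<And>i. norm (c i) \<le> K" by (auto simp: Bseq_def)
  moreover obtain k :: nat where "K \<le> real k" using real_arch_simple by blast
  ultimately show ?thesis using that order_trans by blast
qed

lemma c_null_finite_support:
  assumes "\<And>i. i \<ge> N \<Longrightarrow> c i = 0"
  shows "c \<in> c_null"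
proof -
  have "eventually (\<lambda>i. c i = 0) sequentially"
    using assms eventually_sequentially by auto
  then show ?thesis by (simp add: c_null_def tendsto_eventually)
qed

context fnormed_space
begin

text \<open>As \<open>0 \<in> W\<close>, this combines independence and lineability over \<open>c_null\<close>, relative to the
  complement of \<open>W\<close>.\<close>

definition c0_independent_mod :: "'e set \<Rightarrow> (nat \<Rightarrow> 'e) \<Rightarrow> bool"
  where "c0_independent_mod W x \<longleftrightarrow>
    (\<forall>c\<in>c_null. \<exists>l. qlim (\<lambda>N. \<Sum>n<N. c n \<odot> x n) l \<and> (l \<in> W \<longrightarrow> (\<forall>n. c n = 0)))"

lemma summable_q_scale:
  assumes "summable (\<lambda>n. q (x n))" "\<And>i. norm (c i) \<le> real k"
  shows "summable (\<lambda>n. q (c n \<odot> x n))"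
proof (rule summable_comparison_test)
  show "\<exists>N. \<forall>n\<ge>N. norm (q (c n \<odot> x n)) \<le> real k * q (x n)"
    using q_scale_bound[OF assms(2)] by simp
  show "summable (\<lambda>n. real k * q (x n))" by (rule summable_mult[OF assms(1)])
qed

lemma not_in_span_scale:
  assumes "t \<noteq> 0" "y \<notin> span S"
  shows "t \<odot> y \<notin> span S"
proof
  assume "t \<odot> y \<in> span S"
  then have "inverse t \<odot> (t \<odot> y) \<in> span S" by (rule span_scale)
  then show False using assms by simp
qed

lemma small_nonzero_multiple:
  assumes "0 < e"
  obtains t where "t \<noteq> 0" "norm t \<le> 1" "q (t \<odot> y) < e"
proof -
  obtain d where d: "d > 0" "\<And>c. norm c < d \<Longrightarrow> q (c \<odot> y) < e"
    using q_scale_small[OF assms, of y] by auto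
  define t where "t = (of_real (min 1 (d / 2)) :: 'k)"
  have "norm t = min 1 (d / 2)" using d(1) by (simp add: t_def)
  then have "t \<noteq> 0" "norm t \<le> 1" "norm t < d" using d(1) by (auto simp: min_def split: if_splits)
  then show ?thesis using d(2) that by blast
qed

text \<open>A null sequence attains its supremum norm, at an index \<open>n\<close> say; the multiples of the
  \<open>y i\<close> are chosen so small that the terms after \<open>n\<close> cannot compensate the distance of the
  \<open>n\<close>-th term from the span of the earlier ones.\<close>

lemma ex_c0_independent:
  assumes "\<And>n. y n \<notin> span (y ` {..<n})"
  obtains x t where "\<And>n. x n = t n \<odot> y n" "\<And>n. t n \<noteq> 0" "summable (\<lambda>n. q (x n))"
    "c0_independent_mod {0} x"
proof -
  define L where "L n = span (y ` {..<n})" for n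
  have far: "\<exists>d>0. \<forall>h c. h \<in> L n \<longrightarrow> norm c = 1 \<longrightarrow> d \<le> q (h + c \<odot> f)" if fL: "f \<notin> L n" for f n
  proof -
    have "subspace (L n)" "qclosed (L n)" by (simp_all add: L_def qclosed_span_finite)
    then obtain d where "d > 0" "\<And>h c. \<lbrakk>h \<in> L n; norm c = 1\<rbrakk> \<Longrightarrow> d \<le> q (h + c \<odot> f)"
      using fL by (rule dist_to_subspace) blast
    then show ?thesis by blast
  qed
  \<comment> \<open>A state holds the multiplier \<open>t n\<close> and a bound \<open>D n\<close>
    for the size of the \<open>n\<close>-th term. The next bound is chosen once this term is fixed,
    at most a quarter of its distance from \<open>L n\<close>: half of \<open>4 * D (Suc n)\<close>
    is spent on all later terms, the other half on the error of the partial sum.\<close>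
  define R where "R = (\<lambda>n (u :: 'k \<times> real) (v :: 'k \<times> real). snd v \<le> snd u / 2 \<and>
    (\<forall>h c. h \<in> L n \<longrightarrow> norm c = 1 \<longrightarrow> 4 * snd v \<le> q (h + c \<odot> (fst u \<odot> y n))))"
  define I where "I = (\<lambda>n (u :: 'k \<times> real). fst u \<noteq> 0 \<and> 0 < snd u \<and> q (fst u \<odot> y n) \<le> snd u)"
  have ex: "\<exists>t. I n (t, D)" if D: "0 < D" for n D
  proof -
    obtain t where "t \<noteq> 0" "q (t \<odot> y n) < D" by (rule small_nonzero_multiple[OF D, of "y n"]) blast
    then show ?thesis using D by (intro exI[of _ t]) (simp add: I_def)
  qed
  have "\<exists>f. \<forall>n. I n (f n) \<and> R n (f n) (f (Suc n))"
  proof (rule dependent_nat_choice)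
    show "\<exists>u. I 0 u" using ex[of 1 0] by auto
    fix u n assume u: "I n u"
    then have "fst u \<odot> y n \<notin> L n"
      unfolding L_def I_def using not_in_span_scale assms by blast
    then obtain d where d: "d > 0" "\<And>h c. h \<in> L n \<Longrightarrow> norm c = 1 \<Longrightarrow> d \<le> q (h + c \<odot> (fst u \<odot> y n))"
      using far by blast
    define D where "D = min (snd u / 2) (d / 4)"
    have "0 < D" using d(1) u by (simp add: D_def I_def)
    then obtain t where "I (Suc n) (t, D)" using ex by blast
    moreover have "R n u (t, D)"
    proof -
      have "4 * D \<le> d" "D \<le> snd u / 2" by (simp_all add: D_def min_def)
      with d(2) show ?thesis
        unfolding R_def snd_conv by (blast intro: order_trans)
    qed
    ultimately show "\<exists>v. I (Suc n) v \<and> R n u v" by blast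
  qed
  then obtain f where f: "\<And>n. I n (f n)" "\<And>n. R n (f n) (f (Suc n))" by blast
  define t where "t n = fst (f n)" for n
  define D where "D n = snd (f n)" for n
  define x where "x n = t n \<odot> y n" for n
  have t: "t n \<noteq> 0" and Dpos: "0 < D n" and xD: "q (x n) \<le> D n" for n
    using f(1)[of n] by (auto simp: I_def t_def D_def x_def)
  have Dhalf: "D (Suc n) \<le> D n / 2"
    and far: "\<And>h c. h \<in> L n \<Longrightarrow> norm c = 1 \<Longrightarrow> 4 * D (Suc n) \<le> q (h + c \<odot> x n)" for n
    using f(2)[of n] by (auto simp: R_def t_def D_def x_def)
  note halving = summable_le_halving[of "\<lambda>n. q (x n)" D, OF q_nonneg xD Dhalf]
  have "c0_independent_mod {0} x"
    unfolding c0_independent_mod_def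
  proof
    fix c :: "nat \<Rightarrow> 'k" assume c: "c \<in> c_null"
    obtain k :: nat where k: "\<And>i. norm (c i) \<le> real k" using c_null_bounded[OF c] by blast
    obtain l where l: "qlim (\<lambda>N. \<Sum>n<N. c n \<odot> x n) l"
      using qlim_ex_if_summable[OF summable_q_scale[of x c k, OF halving(1) k]] by blast
    have "\<forall>n. c n = 0" if "l = 0"
    proof (rule ccontr)
      assume "\<not> (\<forall>n. c n = 0)"
      then obtain n where n: "c n \<noteq> 0" "\<And>i. norm (c i) \<le> norm (c n)"
        using c_null_max[OF c] by metis
      define b where "b i = inverse (c n) * c i" for i
      have b: "norm (b i) \<le> 1" for i
      proof -
        have "norm (b i) = norm (c i) / norm (c n)"
          by (simp add: b_def norm_mult norm_inverse divide_inverse mult.commute)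
        then show ?thesis using n(2)[of i] n(1) by (simp add: divide_le_eq_1)
      qed
      have "b n = 1" using n by (simp add: b_def)
      have "qlim (\<lambda>N. inverse (c n) \<odot> (\<Sum>i<N. c i \<odot> x i)) (inverse (c n) \<odot> l)"
        by (rule qlim_scale[OF l])
      then have lim: "qlim (\<lambda>N. \<Sum>i<N. b i \<odot> x i) 0"
        using that by (simp add: b_def scale_sum_right)
      then obtain N0 where N0: "\<And>N. N \<ge> N0 \<Longrightarrow> q (\<Sum>i<N. b i \<odot> x i) < 2 * D (Suc n)"
        using Dpos[of "Suc n"] unfolding qlim_iff by fastforce
      define N where "N = max N0 (Suc n)"
      have "{..<N} = {..<Suc n} \<union> {Suc n..<N}" by (auto simp: N_def)
      then have "(\<Sum>i<N. b i \<odot> x i) = (\<Sum>i<Suc n. b i \<odot> x i) + (\<Sum>i\<in>{Suc n..<N}. b i \<odot> x i)"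
        by (simp only: sum.union_disjoint finite_lessThan finite_atLeastLessThan ivl_disj_int)
      then have split: "(\<Sum>i<N. b i \<odot> x i) - (\<Sum>i\<in>{Suc n..<N}. b i \<odot> x i)
          = (\<Sum>i<n. b i \<odot> x i) + b n \<odot> x n"
        by simp
      have "q (\<Sum>i\<in>{Suc n..<N}. b i \<odot> x i) \<le> (\<Sum>i\<in>{Suc n..<N}. q (x i))"
        by (rule order_trans[OF q_sum]) (intro sum_mono q_scale_le b)
      also have "\<dots> \<le> 2 * D (Suc n)" by (rule halving(2))
      finally have tail: "q (\<Sum>i\<in>{Suc n..<N}. b i \<odot> x i) \<le> 2 * D (Suc n)" .
      have "(\<Sum>i<n. b i \<odot> x i) \<in> L n"
        unfolding L_def x_def by (intro span_sum span_scale span_base) auto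
      then have "4 * D (Suc n) \<le> q ((\<Sum>i<n. b i \<odot> x i) + b n \<odot> x n)"
        by (rule far) (simp add: \<open>b n = 1\<close>)
      also have "\<dots> < 2 * D (Suc n) + 2 * D (Suc n)"
        unfolding split[symmetric]
        using q_diff[of "\<Sum>i<N. b i \<odot> x i" "\<Sum>i\<in>{Suc n..<N}. b i \<odot> x i"] tail N0[of N]
        by (simp add: N_def)
      finally show False by simp
    qed
    with l show "\<exists>l. qlim (\<lambda>N. \<Sum>n<N. c n \<odot> x n) l \<and> (l \<in> {0} \<longrightarrow> (\<forall>n. c n = 0))" by blast
  qed
  then show ?thesis using that[of x t] halving(1) t x_def by blast
qed

lemma infinite_independent_sequence:
  assumes "independent B" "infinite B"
  obtains y :: "nat \<Rightarrow> 'e" where "range y \<subseteq> B" "\<And>n. y n \<notin> span (y ` {..<n})"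
proof -
  obtain y :: "nat \<Rightarrow> 'e" where y: "inj y" "range y \<subseteq> B"
    using infinite_countable_subset[OF assms(2)] by blast
  have "y n \<notin> span (y ` {..<n})" for n
  proof
    assume n: "y n \<in> span (y ` {..<n})"
    have "y ` {..<n} \<subseteq> range y - {y n}" using y(1) by (auto dest: injD)
    then have "y n \<in> span (range y - {y n})" using n span_mono by blast
    then have "dependent (range y)" unfolding dependent_def by blast
    then show False using assms(1) y(2) dependent_mono by blast
  qed
  with y(2) that show ?thesis by blast
qed

lemma c0_independent_in_closed_subspace:
  fixes y :: "nat \<Rightarrow> 'e"
  assumes "subspace F" "qclosed F" and y: "range y \<subseteq> F" "\<And>n. y n \<notin> span (y ` {..<n})"
  obtains x where "range x \<subseteq> F" "c0_independent_mod {0} x"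
    "\<And>c l. qlim (\<lambda>N. \<Sum>n<N. c n \<odot> x n) l \<Longrightarrow> l \<in> F"
proof -
  obtain x t where x: "\<And>n. x n = t n \<odot> y n" "c0_independent_mod {0} x"
    by (rule ex_c0_independent[of y, OF y(2)]) metis
  have xF: "x n \<in> F" for n
    unfolding x(1) using y(1) by (intro subspace_scale[OF assms(1)]) blast
  have "l \<in> F" if "qlim (\<lambda>N. \<Sum>n<N. c n \<odot> x n) l" for c l
    by (rule qclosed_limit[OF assms(2) _ that])
      (use xF in \<open>auto intro!: subspace_sum[OF assms(1)] subspace_scale[OF assms(1)]\<close>)
  then show ?thesis using that x(2) xF by blast
qed

text \<open>If a nontrivial combination of the even terms and one of the odd terms both met
  \<open>W + Kf\<close>, eliminating \<open>f\<close> would give a nontrivial combination in \<open>W\<close>.\<close>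

lemma c0_independent_mod_add_line:
  assumes W: "subspace W" and x: "c0_independent_mod W x"
  shows "\<exists>g. c0_independent_mod {h + c \<odot> f |h c. h \<in> W} (x \<circ> (g :: nat \<Rightarrow> nat))"
proof -
  \<comment> \<open>Padding with zeros turns a series over the even or the odd terms of
    \<open>x\<close> into a series over \<open>x\<close>, to which the hypothesis applies.\<close>
  define ev where "ev c = (\<lambda>n. if even n then c (n div 2) else 0)" for c :: "nat \<Rightarrow> 'k"
  define od where "od c = (\<lambda>n. if odd n then c (n div 2) else 0)" for c :: "nat \<Rightarrow> 'k"
  have null: "ev c \<in> c_null" "od c \<in> c_null" if "c \<in> c_null" for c
  proof -
    have "filterlim (\<lambda>n::nat. n div 2) at_top sequentially"
      by (rule filterlim_at_top_div_const_nat) simp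
    then have lim: "(\<lambda>n. c (n div 2)) \<longlonglongrightarrow> 0"
      using that filterlim_compose[of c] by (simp add: c_null_def)
    show "ev c \<in> c_null" "od c \<in> c_null"
      unfolding c_null_def ev_def od_def
      by (auto intro!: Lim_null_comparison[OF _ tendsto_norm_zero[OF lim]] always_eventually)
  qed
  have sums: "(\<Sum>n<2*m. ev c n \<odot> x n) = (\<Sum>n<m. c n \<odot> x (2*n))"
      "(\<Sum>n<2*m. od c n \<odot> x n) = (\<Sum>n<m. c n \<odot> x (2*n+1))" for c m
    by (induction m) (auto simp: ev_def od_def)
  have sub: "qlim (\<lambda>m. s (2*m)) l" if "qlim s l" for s l
    using LIMSEQ_subseq_LIMSEQ[OF that, of "\<lambda>m. 2*m"] by (simp add: strict_mono_def o_def)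
  let ?E = "\<lambda>n::nat. 2*n" and ?O = "\<lambda>n::nat. 2*n+1"
  have lims: "\<exists>l. qlim (\<lambda>N. \<Sum>n<N. ev c n \<odot> x n) l \<and> qlim (\<lambda>N. \<Sum>n<N. c n \<odot> (x \<circ> ?E) n) l"
    "\<exists>l. qlim (\<lambda>N. \<Sum>n<N. od c n \<odot> x n) l \<and> qlim (\<lambda>N. \<Sum>n<N. c n \<odot> (x \<circ> ?O) n) l"
    if cn: "c \<in> c_null" for c
  proof -
    obtain l where "qlim (\<lambda>N. \<Sum>n<N. ev c n \<odot> x n) l"
      using x null(1)[OF cn] unfolding c0_independent_mod_def by blast
    with sub[OF this] show "\<exists>l. qlim (\<lambda>N. \<Sum>n<N. ev c n \<odot> x n) l \<and> qlim (\<lambda>N. \<Sum>n<N. c n \<odot> (x \<circ> ?E) n) l"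
      unfolding o_apply sums by blast
    obtain l where "qlim (\<lambda>N. \<Sum>n<N. od c n \<odot> x n) l"
      using x null(2)[OF cn] unfolding c0_independent_mod_def by blast
    with sub[OF this] show "\<exists>l. qlim (\<lambda>N. \<Sum>n<N. od c n \<odot> x n) l \<and> qlim (\<lambda>N. \<Sum>n<N. c n \<odot> (x \<circ> ?O) n) l"
      unfolding o_apply sums by blast
  qed
  show ?thesis
  proof (rule ccontr)
    assume "\<not> ?thesis"
    then have nE: "\<not> c0_independent_mod {h + c \<odot> f |h c. h \<in> W} (x \<circ> ?E)"
      and nO: "\<not> c0_independent_mod {h + c \<odot> f |h c. h \<in> W} (x \<circ> ?O)" by blast+
    obtain c where c: "c \<in> c_null" "\<And>l. qlim (\<lambda>N. \<Sum>n<N. c n \<odot> (x \<circ> ?E) n) l \<Longrightarrow>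
        l \<in> {h + c \<odot> f |h c. h \<in> W} \<and> \<not> (\<forall>n. c n = 0)"
      using nE unfolding c0_independent_mod_def by blast
    obtain d where d: "d \<in> c_null" "\<And>l. qlim (\<lambda>N. \<Sum>n<N. d n \<odot> (x \<circ> ?O) n) l \<Longrightarrow>
        l \<in> {h + c \<odot> f |h c. h \<in> W} \<and> \<not> (\<forall>n. d n = 0)"
      using nO unfolding c0_independent_mod_def by blast
    obtain l where l: "qlim (\<lambda>N. \<Sum>n<N. ev c n \<odot> x n) l" "l \<in> {h + c \<odot> f |h c. h \<in> W}"
        "\<not> (\<forall>n. c n = 0)"
      using lims(1)[OF c(1)] c(2) by blast
    obtain m where m: "qlim (\<lambda>N. \<Sum>n<N. od d n \<odot> x n) m" "m \<in> {h + c \<odot> f |h c. h \<in> W}"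
        "\<not> (\<forall>n. d n = 0)"
      using lims(2)[OF d(1)] d(2) by blast
    obtain h a where ha: "l = h + a \<odot> f" "h \<in> W" using l(2) by blast
    obtain k b where kb: "m = k + b \<odot> f" "k \<in> W" using m(2) by blast
    have uniq: "\<forall>n. e n = 0" if "e \<in> c_null" "qlim (\<lambda>N. \<Sum>n<N. e n \<odot> x n) v" "v \<in> W" for e v
    proof -
      obtain l where "qlim (\<lambda>N. \<Sum>n<N. e n \<odot> x n) l" "l \<in> W \<Longrightarrow> \<forall>n. e n = 0"
        using x \<open>e \<in> c_null\<close> unfolding c0_independent_mod_def by blast
      then show ?thesis using qlim_unique[OF _ \<open>qlim _ v\<close>, of l] \<open>v \<in> W\<close> by simp
    qed
    have "b \<noteq> 0"
    proof
      assume "b = 0"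
      then have "\<forall>n. od d n = 0" using uniq[OF null(2)[OF d(1)] m(1)] kb by simp
      then have "od d (2*n+1) = 0" for n by blast
      then have "d n = 0" for n by (simp add: od_def)
      then show False using m(3) by blast
    qed
    define e where "e n = b * ev c n - a * od d n" for n
    have "e \<in> c_null"
      using null(1)[OF c(1)] null(2)[OF d(1)] unfolding e_def c_null_def
      by (auto intro!: tendsto_eq_intros)
    moreover have "qlim (\<lambda>N. \<Sum>n<N. e n \<odot> x n) (b \<odot> l - a \<odot> m)"
      using qlim_diff[OF qlim_scale[OF l(1), of b] qlim_scale[OF m(1), of a]]
      by (simp add: e_def scale_sum_right scale_left_diff_distrib sum_subtractf)
    moreover have "b \<odot> l - a \<odot> m = b \<odot> h - a \<odot> k"
      by (simp add: ha kb scale_right_distrib mult.commute)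
    moreover have "b \<odot> h - a \<odot> k \<in> W"
      using ha kb W by (simp add: subspace_diff subspace_scale)
    ultimately have e0: "\<forall>n. e n = 0" using uniq by metis
    have "c n = 0" for n
      using e0[rule_format, of "2*n"] \<open>b \<noteq> 0\<close> by (simp add: e_def ev_def od_def)
    then show False using l(3) by blast
  qed
qed

lemma c0_independent_mod_finite:
  assumes "subspace W" "c0_independent_mod W x" "finite B"
  shows "\<exists>x. c0_independent_mod (span (W \<union> B)) x"
  using \<open>finite B\<close>
proof (induction B rule: finite_induct)
  case empty
  then show ?case using assms(1,2) by (auto simp: span_eq_iff[THEN iffD2])
next
  case (insert f B)
  then show ?case
    unfolding span_Un_insert_line using c0_independent_mod_add_line[OF subspace_span] by blast
qed

end

section \<open>Strictly weaker vector topologies\<close>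

text \<open>\<open>\<N>\<close> is a base of balanced neighbourhoods of zero of a Hausdorff vector topology on \<open>M\<close>.\<close>

locale weak_nbhd_base = fnormed_space scale q
  for scale :: "'k::{real_normed_field,heine_borel} \<Rightarrow> 'e::ab_group_add \<Rightarrow> 'e" (infixr "\<odot>" 75)
    and q :: "'e \<Rightarrow> real" +
  fixes M :: "'e set" and \<N> :: "'e set set"
  assumes M: "subspace M" "qclosed M"
    and N_nonempty: "\<N> \<noteq> {}"
    and N_subset: "Q \<in> \<N> \<Longrightarrow> Q \<subseteq> M"
    and N_zero: "Q \<in> \<N> \<Longrightarrow> 0 \<in> Q"
    and N_scale: "\<lbrakk>Q \<in> \<N>; norm c \<le> 1; t \<in> Q\<rbrakk> \<Longrightarrow> c \<odot> t \<in> Q"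
    and N_add: "Q \<in> \<N> \<Longrightarrow> \<exists>P\<in>\<N>. \<forall>s\<in>P. \<forall>t\<in>P. s + t \<in> Q"
    and N_Int: "\<lbrakk>P \<in> \<N>; Q \<in> \<N>\<rbrakk> \<Longrightarrow> \<exists>R\<in>\<N>. R \<subseteq> P \<inter> Q"
    and N_weaker: "Q \<in> \<N> \<Longrightarrow> \<exists>r>0. \<forall>u\<in>M. q u < r \<longrightarrow> u \<in> Q"
    and N_Hausdorff: "\<lbrakk>x \<in> M; x \<noteq> 0\<rbrakk> \<Longrightarrow> \<exists>Q\<in>\<N>. x \<notin> Q"
    and N_strictly_weaker: "\<exists>r>0. \<forall>Q\<in>\<N>. \<not> Q \<subseteq> {u. q u < r}"
begin

text \<open>The closure of the ball of radius \<open>r\<close> of \<open>M\<close> in the weaker topology.\<close>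

definition V :: "real \<Rightarrow> 'e set"
  where "V r = {x \<in> M. \<forall>Q\<in>\<N>. \<exists>u\<in>M. q u < r \<and> x - u \<in> Q}"

lemma V_subset: "V r \<subseteq> M"
  by (auto simp: V_def)

lemma ball_in_V:
  assumes "u \<in> M" "q u < r"
  shows "u \<in> V r"
  unfolding V_def
proof (intro CollectI conjI ballI)
  fix Q assume "Q \<in> \<N>"
  then have "u - u \<in> Q" using N_zero by simp
  then show "\<exists>v\<in>M. q v < r \<and> u - v \<in> Q" using assms by blast
qed (fact assms(1))

lemma V_mono:
  assumes "x \<in> V r" "r \<le> s"
  shows "x \<in> V s"
proof -
  have "q u < r \<Longrightarrow> q u < s" for u using assms(2) by simp
  then show ?thesis using assms(1) unfolding V_def by blast
qed

lemma V_add: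
  assumes "x \<in> V r" "y \<in> V s"
  shows "x + y \<in> V (r + s)"
  unfolding V_def
proof (intro CollectI conjI ballI)
  show "x + y \<in> M" using assms V_subset subspace_add[OF M(1)] by blast
  fix Q assume "Q \<in> \<N>"
  then obtain P where P: "P \<in> \<N>" "\<And>s t. \<lbrakk>s \<in> P; t \<in> P\<rbrakk> \<Longrightarrow> s + t \<in> Q"
    using N_add by metis
  obtain u where u: "u \<in> M" "q u < r" "x - u \<in> P" using assms(1) P(1) unfolding V_def by blast
  obtain v where v: "v \<in> M" "q v < s" "y - v \<in> P" using assms(2) P(1) unfolding V_def by blast
  have "x + y - (u + v) \<in> Q" using P(2)[OF u(3) v(3)] by (simp add: algebra_simps)
  moreover have "q (u + v) < r + s" using q_add[of u v] u(2) v(2) by linarith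
  ultimately show "\<exists>w\<in>M. q w < r + s \<and> x + y - w \<in> Q"
    using subspace_add[OF M(1) u(1) v(1)] by blast
qed

lemma V_scale:
  assumes "norm c \<le> 1" "x \<in> V r"
  shows "c \<odot> x \<in> V r"
  unfolding V_def
proof (intro CollectI conjI ballI)
  show "c \<odot> x \<in> M" using assms V_subset subspace_scale[OF M(1)] by blast
  fix Q assume Q: "Q \<in> \<N>"
  then obtain u where u: "u \<in> M" "q u < r" "x - u \<in> Q" using assms(2) unfolding V_def by blast
  have "c \<odot> x - c \<odot> u \<in> Q"
    using N_scale[OF Q assms(1) u(3)] by (simp add: scale_right_diff_distrib)
  moreover have "q (c \<odot> u) < r" using q_scale_le[OF assms(1), of u] u(2) by linarith
  ultimately show "\<exists>w\<in>M. q w < r \<and> c \<odot> x - w \<in> Q"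
    using subspace_scale[OF M(1) u(1)] by blast
qed

lemma V_diff: "\<lbrakk>x \<in> V r; y \<in> V s\<rbrakk> \<Longrightarrow> x - y \<in> V (r + s)"
  using V_add[of x r "- y" s] V_scale[of "-1" y s] by simp

lemma V_perturb:
  assumes "x \<in> V r" "y \<in> M" "q (y - x) < s"
  shows "y \<in> V (r + s)"
proof -
  have "y - x \<in> V s"
    using assms V_subset by (intro ball_in_V subspace_diff[OF M(1)]) auto
  from V_add[OF assms(1) this] show ?thesis by simp
qed

text \<open>A weak neighbourhood \<open>P\<close> contains a ball of \<open>q\<close>, so
  \<open>x\<close> is the sum of \<open>x - u\<close> and \<open>u\<close>, both in
  \<open>P\<close>. Hence \<open>x\<close> lies in every weak neighbourhood of zero.\<close>

lemma V_all_imp_zero: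
  assumes "\<And>r. 0 < r \<Longrightarrow> x \<in> V r"
  shows "x = 0"
proof (rule ccontr)
  assume "x \<noteq> 0"
  moreover have "x \<in> M" using assms[of 1] V_subset by auto
  ultimately obtain Q where Q: "Q \<in> \<N>" "x \<notin> Q" using N_Hausdorff by blast
  obtain P where P: "P \<in> \<N>" "\<And>s t. \<lbrakk>s \<in> P; t \<in> P\<rbrakk> \<Longrightarrow> s + t \<in> Q"
    using N_add[OF Q(1)] by metis
  obtain r where r: "0 < r" "\<And>u. \<lbrakk>u \<in> M; q u < r\<rbrakk> \<Longrightarrow> u \<in> P" using N_weaker[OF P(1)] by blast
  obtain u where "u \<in> M" "q u < r" "x - u \<in> P"
    using assms[OF r(1)] P(1) unfolding V_def by blast
  then have "(x - u) + u \<in> Q" using P(2) r(2) by blast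
  then show False using Q(2) by simp
qed

lemma N_finite_Int:
  assumes "finite D" "\<And>d. d \<in> D \<Longrightarrow> f d \<in> \<N>"
  shows "\<exists>R\<in>\<N>. \<forall>d\<in>D. R \<subseteq> f d"
  using assms
proof (induction D rule: finite_induct)
  case empty
  then show ?case using N_nonempty by blast
next
  case (insert d D)
  then obtain R where R: "R \<in> \<N>" "\<forall>d\<in>D. R \<subseteq> f d" by auto
  obtain R' where "R' \<in> \<N>" "R' \<subseteq> R \<inter> f d" using N_Int[OF R(1) insert.prems[of d]] by auto
  with R(2) show ?case by blast
qed

text \<open>Total boundedness with respect to \<open>q\<close>. The nets need not lie in
  \<open>C\<close>, but they lie in \<open>M\<close>, where membership in \<open>V\<close> makes
  sense.\<close>

definition tbounded :: "'e set \<Rightarrow> bool"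
  where "tbounded C \<longleftrightarrow> (\<forall>e>0. \<exists>D. finite D \<and> D \<subseteq> M \<and> (\<forall>k\<in>C. \<exists>d\<in>D. q (k - d) < e))"

lemma tbounded_zero: "tbounded {0}"
  unfolding tbounded_def using subspace_0[OF M(1)] by (intro allI impI exI[of _ "{0}"]) auto

text \<open>The unit disc of the scalars is compact, so finitely many multiples of \<open>y\<close>
  approximate all those allowed.\<close>

lemma tbounded_add_disc:
  assumes C: "tbounded C" and y: "y \<in> M"
  shows "tbounded {b + c \<odot> y |b c. b \<in> C \<and> norm c \<le> 1}"
  unfolding tbounded_def
proof (intro allI impI)
  fix e :: real assume "0 < e"
  then obtain D where D: "finite D" "D \<subseteq> M" "\<And>k. k \<in> C \<Longrightarrow> \<exists>d\<in>D. q (k - d) < e / 2"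
    using C unfolding tbounded_def by (meson half_gt_zero)
  obtain h where h: "h > 0" "\<And>c. norm c < h \<Longrightarrow> q (c \<odot> y) < e / 2"
    using q_scale_small[of "e / 2" y] \<open>0 < e\<close> by auto
  have "compact (cball (0::'k) 1)" by simp
  then obtain S where S: "finite S" "cball (0::'k) 1 \<subseteq> (\<Union>a\<in>S. ball a h)"
    using h(1) unfolding compact_eq_totally_bounded by blast
  define T where "T = (\<lambda>(d, a). d + a \<odot> y) ` (D \<times> S)"
  show "\<exists>D. finite D \<and> D \<subseteq> M \<and> (\<forall>k\<in>{b + c \<odot> y |b c. b \<in> C \<and> norm c \<le> 1}. \<exists>d\<in>D. q (k - d) < e)"
  proof (intro exI[of _ T] conjI ballI)
    show "finite T" using D(1) S(1) by (simp add: T_def)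
    show "T \<subseteq> M" using D(2) y subspace_add[OF M(1)] subspace_scale[OF M(1)] by (auto simp: T_def)
    fix k assume "k \<in> {b + c \<odot> y |b c. b \<in> C \<and> norm c \<le> 1}"
    then obtain b c where bc: "k = b + c \<odot> y" "b \<in> C" "norm c \<le> 1" by blast
    obtain d where d: "d \<in> D" "q (b - d) < e / 2" using D(3)[OF bc(2)] by blast
    have "c \<in> cball 0 1" using bc(3) by simp
    then obtain a where a: "a \<in> S" "norm (c - a) < h"
      using S(2) by (auto simp: dist_norm norm_minus_commute)
    have "k - (d + a \<odot> y) = (b - d) + (c - a) \<odot> y"
      by (simp add: bc(1) scale_left_diff_distrib)
    moreover have "q ((b - d) + (c - a) \<odot> y) < e"
      using q_add[of "b - d" "(c - a) \<odot> y"] d(2) h(2)[OF a(2)] by linarith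
    ultimately have "q (k - (d + a \<odot> y)) < e" by (simp only:)
    moreover have "d + a \<odot> y \<in> T" using d(1) a(1) by (force simp: T_def)
    ultimately show "\<exists>d\<in>T. q (k - d) < e" by blast
  qed
qed

text \<open>This is weak closedness of \<open>V\<close> made uniform over a totally bounded set:
  each net point outside \<open>V (r + h)\<close> is separated from a ball by a weak neighbourhood,
  and finitely many net points share one. Of the gap \<open>s - r\<close>, one half goes into
  passing from \<open>k\<close> to a net point, the other into returning.\<close>

lemma V_shift:
  assumes C: "tbounded C" "C \<subseteq> M" and "r < s"
  shows "\<exists>Q\<in>\<N>. \<forall>k\<in>C. \<forall>t\<in>Q. k + t \<in> V r \<longrightarrow> k \<in> V s"
proof -
  define h where "h = (s - r) / 2"
  have h: "0 < h" using \<open>r < s\<close> by (simp add: h_def)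
  obtain D where D: "finite D" "D \<subseteq> M" "\<And>k. k \<in> C \<Longrightarrow> \<exists>d\<in>D. q (k - d) < h"
    using C(1)[unfolded tbounded_def, rule_format, OF h] by (elim exE conjE) blast
  \<comment> \<open>Two summands from \<open>P\<close> are allowed because one absorbs the distance
    of \<open>k + t\<close> from the ball and the other removes \<open>t\<close>.\<close>
  define sep where "sep = (\<lambda>d P. d \<notin> V (r + h) \<longrightarrow>
      (\<forall>u\<in>M. q u < r + h \<longrightarrow> (\<forall>s\<in>P. \<forall>t\<in>P. d - u \<noteq> s + t)))"
  have ex: "\<exists>P\<in>\<N>. sep d P" if d: "d \<in> D" for d
  proof (cases "d \<in> V (r + h)")
    case True
    then show ?thesis using N_nonempty by (auto simp: sep_def)
  next
    case False
    then obtain Q where Q: "Q \<in> \<N>" "\<And>u. \<lbrakk>u \<in> M; q u < r + h\<rbrakk> \<Longrightarrow> d - u \<notin> Q"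
      using d D(2) unfolding V_def by blast
    obtain P where P: "P \<in> \<N>" "\<And>s t. \<lbrakk>s \<in> P; t \<in> P\<rbrakk> \<Longrightarrow> s + t \<in> Q"
      using N_add[OF Q(1)] by metis
    have "d - u \<noteq> s + t" if "u \<in> M" "q u < r + h" "s \<in> P" "t \<in> P" for u s t
      using P(2)[OF that(3,4)] Q(2)[OF that(1,2)] by auto
    then show ?thesis using P(1) unfolding sep_def by blast
  qed
  then obtain f where f: "\<And>d. d \<in> D \<Longrightarrow> f d \<in> \<N>" "\<And>d. d \<in> D \<Longrightarrow> sep d (f d)"
    by metis
  have "\<exists>R\<in>\<N>. \<forall>d\<in>D. R \<subseteq> f d" by (rule N_finite_Int[OF D(1) f(1)])
  then obtain R where R: "R \<in> \<N>" "\<And>d. d \<in> D \<Longrightarrow> R \<subseteq> f d" by blast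
  have "k \<in> V s" if k: "k \<in> C" "t \<in> R" "k + t \<in> V r" for k t
  proof -
    obtain d where d: "d \<in> D" "q (k - d) < h" using D(3)[OF k(1)] by blast
    have kM: "k \<in> M" "d \<in> M" using k(1) C(2) d(1) D(2) by auto
    have "d \<in> V (r + h)"
    proof (rule ccontr)
      assume d': "d \<notin> V (r + h)"
      obtain u where u: "u \<in> M" "q u < r" "k + t - u \<in> R"
        using k(3) R(1) unfolding V_def by blast
      have "u + (d - k) \<in> M" using u(1) kM by (intro subspace_add[OF M(1)] subspace_diff[OF M(1)])
      moreover have "q (u + (d - k)) < r + h"
        using q_add[of u "d - k"] u(2) d(2) q_diff_commute[of d k] by linarith
      moreover have "- t \<in> R" using N_scale[OF R(1), of "-1" t] k(2) by simp
      ultimately have "d - (u + (d - k)) \<noteq> (k + t - u) + (- t)"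
        using f(2)[OF d(1)] d' R(2)[OF d(1)] u(3) unfolding sep_def by blast
      then show False by simp
    qed
    then have "k \<in> V (r + h + h)" by (rule V_perturb[OF _ kM(1) d(2)])
    then show ?thesis by (simp add: h_def)
  qed
  then show ?thesis using R(1) by blast
qed

text \<open>The closed graph argument: if every \<open>V r\<close> were a neighbourhood of zero in the weaker
  topology, successive approximation would put \<open>V r\<close> into a ball of radius \<open>3r\<close>, and the two
  topologies would coincide.\<close>

lemma V_not_nbhd: "\<exists>r>0. \<forall>Q\<in>\<N>. \<not> Q \<subseteq> V r"
proof (rule ccontr)
  assume "\<not> ?thesis"
  then have nbhd: "\<exists>Q\<in>\<N>. Q \<subseteq> V r" if "0 < r" for r using that by blast
  have "q x < 3 * r" if r: "0 < r" and x: "x \<in> V r" for r x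
  proof -
    define \<rho> where "\<rho> n = r / 2 ^ n" for n :: nat
    have \<rho>: "0 < \<rho> n" "\<rho> (Suc n) = \<rho> n / 2" for n using r by (auto simp: \<rho>_def)
    have "\<exists>f. \<forall>n. (f n \<in> V (\<rho> n) \<and> (n = 0 \<longrightarrow> f n = x)) \<and>
      (f n - f (Suc n) \<in> M \<and> q (f n - f (Suc n)) < \<rho> n)"
    proof (rule dependent_nat_choice)
      show "\<exists>y. y \<in> V (\<rho> 0) \<and> (0 = 0 \<longrightarrow> y = x)" using x by (auto simp: \<rho>_def)
      fix y n assume y: "y \<in> V (\<rho> n) \<and> (n = 0 \<longrightarrow> y = x)"
      obtain Q where Q: "Q \<in> \<N>" "Q \<subseteq> V (\<rho> (Suc n))" using nbhd \<rho>(1) by blast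
      obtain u where u: "u \<in> M" "q u < \<rho> n" "y - u \<in> Q" using y Q(1) unfolding V_def by blast
      then show "\<exists>w. (w \<in> V (\<rho> (Suc n)) \<and> (Suc n = 0 \<longrightarrow> w = x)) \<and> (y - w \<in> M \<and> q (y - w) < \<rho> n)"
        using Q(2) by (intro exI[of _ "y - u"]) auto
    qed
    then obtain f where f: "\<And>n. f n \<in> V (\<rho> n)" "f 0 = x"
      "\<And>n. f n - f (Suc n) \<in> M" "\<And>n. q (f n - f (Suc n)) < \<rho> n" by blast
    note halving = summable_le_halving[of "\<lambda>n. q (f n - f (Suc n))" \<rho>]
    have tele: "(\<Sum>i<n. f i - f (Suc i)) = x - f n" for n
      by (induction n) (auto simp: f(2))
    have "summable (\<lambda>i. q (f i - f (Suc i)))"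
      by (rule halving(1)) (use f(4) \<rho>(2) in \<open>auto intro: less_imp_le\<close>)
    then obtain e where "qlim (\<lambda>n. \<Sum>i<n. f i - f (Suc i)) e"
      using qlim_ex_if_summable[of "\<lambda>i. f i - f (Suc i)", THEN exE] by metis
    then have e: "qlim (\<lambda>n. x - f n) e" by (simp add: tele)
    have xM: "x \<in> M" using x V_subset by blast
    have fM: "x - f n \<in> M" for n by (rule subspace_diff[OF M(1) xM subsetD[OF V_subset f(1)]])
    have "e \<in> M" by (rule qclosed_limit[OF M(2) fM e])
    \<comment> \<open>The remainders \<open>f n\<close> converge to \<open>x - e\<close> in
      \<open>q\<close> while \<open>f n\<close> lies in \<open>V (\<rho> n)\<close>, so their limit
      lies in every \<open>V s\<close>. This shows that the remainders tend to zero in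
      \<open>q\<close>, not merely weakly.\<close>
    have "x - e = 0"
    proof (rule V_all_imp_zero)
      fix s :: real assume s: "0 < s"
      obtain N1 where N1: "\<And>n. n \<ge> N1 \<Longrightarrow> q (x - f n - e) < s / 2"
        using e s unfolding qlim_iff by (meson half_gt_zero)
      have "\<rho> \<longlonglongrightarrow> 0" unfolding \<rho>_def by (rule LIMSEQ_divide_realpow_zero) simp
      then obtain N2 where N2: "\<And>n. n \<ge> N2 \<Longrightarrow> \<rho> n < s / 2"
        using s \<rho>(1) unfolding LIMSEQ_iff by (metis abs_of_pos diff_zero half_gt_zero real_norm_def)
      define n where "n = max N1 N2"
      have "x - e \<in> V (\<rho> n + s / 2)"
      proof (rule V_perturb[OF f(1)])
        show "x - e \<in> M" by (rule subspace_diff[OF M(1) xM \<open>e \<in> M\<close>])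
        have "x - e - f n = x - f n - e" by simp
        then show "q (x - e - f n) < s / 2" using N1[of n] unfolding n_def by (simp only: max.cobounded1)
      qed
      then show "x - e \<in> V s" by (rule V_mono) (use N2[of n] in \<open>simp add: n_def\<close>)
    qed
    then obtain n where n: "q (f n) < r"
      using e r unfolding qlim_iff by fastforce
    have "q (x - f n) \<le> (\<Sum>i<n. q (f i - f (Suc i)))"
      unfolding tele[symmetric] by (rule q_sum)
    \<comment> \<open>The telescoped corrections cost \<open>2 * r\<close>; a remainder smaller than
      \<open>r\<close> completes the bound \<open>3 * r\<close>.\<close>
    also have "\<dots> \<le> 2 * \<rho> 0"
      unfolding lessThan_atLeast0
      by (rule halving(2)) (use f(4) \<rho>(2) in \<open>auto intro: less_imp_le\<close>)
    finally show ?thesis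
      using q_add[of "x - f n" "f n"] n by (simp add: \<rho>_def)
  qed
  note small = this
  obtain r where r: "0 < r" "\<And>Q. Q \<in> \<N> \<Longrightarrow> \<not> Q \<subseteq> {u. q u < r}"
    using N_strictly_weaker by blast
  have "V (r / 3) \<subseteq> {u. q u < r}" using small[of "r / 3"] r(1) by auto
  moreover obtain Q where "Q \<in> \<N>" "Q \<subseteq> V (r / 3)" using nbhd[of "r / 3"] r(1) by auto
  ultimately show False using r(2) by blast
qed

end

section \<open>A basic sequence in the non-minimal subspace\<close>

context weak_nbhd_base
begin

text \<open>The choices alternate: \<open>B n\<close> contains the combinations of the first
  \<open>n\<close> vectors and is totally bounded, so \<open>V_shift\<close> yields
  \<open>Q n\<close>; then comes \<open>P n\<close> with \<open>P n + P n\<close> inside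
  \<open>Q n\<close>, then \<open>y n\<close> in \<open>P n\<close> but outside \<open>V r\<close>,
  and the next \<open>Q\<close> inside \<open>P n\<close>. The last clause says that deleting a tail
  of a combination only doubles the radius.\<close>

lemma ex_basic_sequence_data:
  assumes r: "0 < r" "\<forall>Q\<in>\<N>. \<not> Q \<subseteq> V r"
  defines "\<rho> \<equiv> \<lambda>m::nat. r / 4 / 2 ^ m"
  shows "\<exists>y B Q. (\<forall>n. y n \<in> M \<and> y n \<notin> V r) \<and>
    (\<forall>a n. (\<forall>i. norm (a i) \<le> 1) \<longrightarrow> (\<Sum>i<n. a i \<odot> y i) \<in> B n) \<and>
    (\<forall>a n N. (\<forall>i. norm (a i) \<le> 1) \<longrightarrow> (\<Sum>i\<in>{n..<N}. a i \<odot> y i) \<in> Q n) \<and>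
    (\<forall>n m k t. m \<le> Suc n \<longrightarrow> k \<in> B n \<longrightarrow> t \<in> Q n \<longrightarrow> k + t \<in> V (\<rho> m) \<longrightarrow> k \<in> V (2 * \<rho> m))"
proof -
  \<comment> \<open>Only finitely many neighbourhoods can be intersected, so stage \<open>n\<close>
    treats the radii up to index \<open>Suc n\<close>; finer ones are added at later stages.\<close>
  define good where "good = (\<lambda>n B Q. \<forall>m\<le>Suc n. \<forall>k\<in>B. \<forall>t\<in>Q. k + t \<in> V (\<rho> m) \<longrightarrow> k \<in> V (2 * \<rho> m))"
  define I where "I = (\<lambda>n (B, Q, P, y). B \<subseteq> M \<and> tbounded B \<and> 0 \<in> B \<and> Q \<in> \<N> \<and> good n B Q \<and>
    P \<in> \<N> \<and> (\<forall>s\<in>P. \<forall>t\<in>P. s + t \<in> Q) \<and> y \<in> P \<and> y \<notin> V r)"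
  define R where "R = (\<lambda>(n::nat) (B, Q :: 'e set, P :: 'e set, y) (B', Q' :: 'e set, P' :: 'e set, y' :: 'e).
    B' = {b + c \<odot> y |b c. b \<in> B \<and> norm c \<le> 1} \<and> Q' \<subseteq> P)"
  have \<rho>: "0 < \<rho> m" for m using r(1) by (simp add: \<rho>_def)
  have ex: "\<exists>Q P y. I n (B, Q, P, y) \<and> Q \<subseteq> P0"
    if B: "B \<subseteq> M" "tbounded B" "0 \<in> B" and P0: "P0 \<in> \<N>" for n B P0
  proof -
    have "\<exists>Q. \<forall>m. Q m \<in> \<N> \<and> (\<forall>k\<in>B. \<forall>t\<in>Q m. k + t \<in> V (\<rho> m) \<longrightarrow> k \<in> V (2 * \<rho> m))"
    proof (rule choice, rule allI)
      fix m
      have "\<rho> m < 2 * \<rho> m" using \<rho>[of m] by simp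
      from V_shift[OF B(2,1) this]
      show "\<exists>Q. Q \<in> \<N> \<and> (\<forall>k\<in>B. \<forall>t\<in>Q. k + t \<in> V (\<rho> m) \<longrightarrow> k \<in> V (2 * \<rho> m))" by blast
    qed
    then obtain q' where q': "\<And>m. q' m \<in> \<N>"
      "\<And>m k t. \<lbrakk>k \<in> B; t \<in> q' m; k + t \<in> V (\<rho> m)\<rbrakk> \<Longrightarrow> k \<in> V (2 * \<rho> m)" by blast
    have "\<exists>Q'\<in>\<N>. \<forall>m\<in>{..Suc n}. Q' \<subseteq> q' m"
      by (rule N_finite_Int) (use q'(1) in auto)
    then obtain Q' where Q': "Q' \<in> \<N>" "\<And>m. m \<le> Suc n \<Longrightarrow> Q' \<subseteq> q' m" by blast
    obtain Q where Q: "Q \<in> \<N>" "Q \<subseteq> Q' \<inter> P0" using N_Int[OF Q'(1) P0] by blast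
    have "good n B Q" unfolding good_def using q'(2) Q'(2) Q(2) by blast
    moreover obtain P where P: "P \<in> \<N>" "\<forall>s\<in>P. \<forall>t\<in>P. s + t \<in> Q" using N_add[OF Q(1)] by blast
    moreover obtain y where "y \<in> P" "y \<notin> V r" using r(2) P(1) by blast
    ultimately have "I n (B, Q, P, y)" using B Q(1) by (simp add: I_def)
    then show ?thesis using Q(2) by blast
  qed
  have "\<exists>f. \<forall>n. I n (f n) \<and> R n (f n) (f (Suc n))"
  proof (rule dependent_nat_choice)
    obtain P0 where "P0 \<in> \<N>" using N_nonempty by blast
    then show "\<exists>u. I 0 u"
      using ex[of "{0}" P0 0] tbounded_zero subspace_0[OF M(1)] by blast
    fix u n assume u: "I n u"
    obtain B Q P y where [simp]: "u = (B, Q, P, y)" by (metis prod_cases4)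
    let ?B = "{b + c \<odot> y |b c. b \<in> B \<and> norm c \<le> 1}"
    have BM: "B \<subseteq> M" and B: "tbounded B" "0 \<in> B" and P: "P \<in> \<N>" and y: "y \<in> P"
      using u by (simp_all add: I_def)
    have yM: "y \<in> M" using N_subset[OF P] y by blast
    have "?B \<subseteq> M" using BM yM subspace_add[OF M(1)] subspace_scale[OF M(1)] by blast
    moreover have "tbounded ?B" by (rule tbounded_add_disc[OF B(1) yM])
    moreover have "0 \<in> ?B" using B(2) by (intro CollectI exI[of _ 0]) simp
    ultimately obtain Q' P' y' where "I (Suc n) (?B, Q', P', y')" "Q' \<subseteq> P"
      using ex[OF _ _ _ P] by blast
    then show "\<exists>v. I (Suc n) v \<and> R n u v"
      by (intro exI[of _ "(?B, Q', P', y')"]) (simp add: R_def)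
  qed
  then obtain f where f: "\<And>n. I n (f n)" "\<And>n. R n (f n) (f (Suc n))" by blast
  define B where "B n = fst (f n)" for n
  define Q where "Q n = fst (snd (f n))" for n
  define P where "P n = fst (snd (snd (f n)))" for n
  define y where "y n = snd (snd (snd (f n)))" for n
  have feq: "f n = (B n, Q n, P n, y n)" for n by (simp add: B_def Q_def P_def y_def)
  have I: "0 \<in> B n" "Q n \<in> \<N>" "good n (B n) (Q n)" "P n \<in> \<N>"
      "\<And>s t. \<lbrakk>s \<in> P n; t \<in> P n\<rbrakk> \<Longrightarrow> s + t \<in> Q n" "y n \<in> P n" "y n \<notin> V r" for n
    using f(1)[of n] by (simp_all add: feq I_def)
  have R: "B (Suc n) = {b + c \<odot> y n |b c. b \<in> B n \<and> norm c \<le> 1}" "Q (Suc n) \<subseteq> P n" for n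
    using f(2)[of n] by (simp_all add: feq R_def)
  have head: "(\<Sum>i<n. a i \<odot> y i) \<in> B n" if "\<And>i. norm (a i) \<le> 1" for a n
  proof (induction n)
    case (Suc n)
    then show ?case unfolding R(1) using that[of n] by auto
  qed (simp add: I(1))
  \<comment> \<open>The first term lies in \<open>P n\<close> and the rest in
    \<open>Q (Suc n)\<close>, hence in \<open>P n\<close> too. Peeling off the first term keeps
    tails of any length in \<open>Q n\<close>, so \<open>n\<close> must vary in the
    induction.\<close>
  have tail: "(\<Sum>i\<in>{n..<n + k}. a i \<odot> y i) \<in> Q n" if a: "\<And>i. norm (a i) \<le> 1" for a n k
  proof (induction k arbitrary: n)
    case 0
    then show ?case using N_zero[OF I(2)] by simp
  next
    case (Suc k)
    have "a n \<odot> y n \<in> P n" by (rule N_scale[OF I(4) a I(6)])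
    moreover have "(\<Sum>i\<in>{Suc n..<Suc n + k}. a i \<odot> y i) \<in> P n" using Suc[of "Suc n"] R(2) by blast
    ultimately have "a n \<odot> y n + (\<Sum>i\<in>{Suc n..<Suc n + k}. a i \<odot> y i) \<in> Q n" by (rule I(5))
    moreover have "(\<Sum>i\<in>{n..<n + Suc k}. a i \<odot> y i)
        = a n \<odot> y n + (\<Sum>i\<in>{Suc n..<n + Suc k}. a i \<odot> y i)"
      by (rule sum.atLeast_Suc_lessThan) simp
    ultimately show ?case by (simp only: add_Suc add_Suc_right)
  qed
  have tail': "(\<Sum>i\<in>{n..<N}. a i \<odot> y i) \<in> Q n" if a: "\<And>i. norm (a i) \<le> 1" for a n N
    using tail[of a n "N - n"] a N_zero[OF I(2), of n] by (cases "n \<le> N") auto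
  have "y n \<in> M \<and> y n \<notin> V r" for n using I(6,7) N_subset[OF I(4)] by blast
  moreover have "k \<in> V (2 * \<rho> m)"
    if "m \<le> Suc n" "k \<in> B n" "t \<in> Q n" "k + t \<in> V (\<rho> m)" for n m k t
    using I(3)[of n] that unfolding good_def by blast
  ultimately show ?thesis
    using head tail' by (rule_tac exI[of _ y], rule_tac exI[of _ B], rule_tac exI[of _ Q]) auto
qed

text \<open>The lower bound gives control of coordinates; the last property guarantees that a limit
  of combinations has no part invisible to the coordinates. Both follow by removing weakly small
  tails.\<close>

lemma ex_basic_sequence:
  obtains y :: "nat \<Rightarrow> 'e" and d where "\<And>n. y n \<in> M" "0 < d"
    "\<And>a j N. \<lbrakk>\<And>i. norm (a i) \<le> 1; j < N; norm (a j) = 1\<rbrakk> \<Longrightarrow> d \<le> q (\<Sum>i<N. a i \<odot> y i)"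
    "\<And>a N g. \<lbrakk>\<And>k i. N k \<le> i \<Longrightarrow> a k i = 0; \<And>e. 0 < e \<Longrightarrow> \<exists>K. \<forall>k\<ge>K. \<forall>i. norm (a k i) < e;
      qlim (\<lambda>k. \<Sum>i<N k. a k i \<odot> y i) g\<rbrakk> \<Longrightarrow> g = 0"
proof -
  obtain r where r: "0 < r" "\<forall>Q\<in>\<N>. \<not> Q \<subseteq> V r" using V_not_nbhd by blast
  define \<rho> where "\<rho> m = r / 4 / 2 ^ m" for m :: nat
  have \<rho>: "0 < \<rho> m" for m using r(1) by (simp add: \<rho>_def)
  obtain y B Q where data: "\<forall>n. y n \<in> M \<and> y n \<notin> V r"
    "\<forall>a n. (\<forall>i. norm (a i) \<le> 1) \<longrightarrow> (\<Sum>i<n. a i \<odot> y i) \<in> B n"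
    "\<forall>a n N. (\<forall>i. norm (a i) \<le> 1) \<longrightarrow> (\<Sum>i\<in>{n..<N}. a i \<odot> y i) \<in> Q n"
    "\<forall>n m k t. m \<le> Suc n \<longrightarrow> k \<in> B n \<longrightarrow> t \<in> Q n \<longrightarrow> k + t \<in> V (\<rho> m) \<longrightarrow> k \<in> V (2 * \<rho> m)"
    using ex_basic_sequence_data[OF r, folded \<rho>_def] by (elim exE conjE) (rule that)
  have y: "y n \<in> M" "y n \<notin> V r" for n using data(1) by simp_all
  have head: "(\<Sum>i<n. a i \<odot> y i) \<in> B n" if "\<And>i. norm (a i) \<le> 1" for a n
    using data(2) that by simp
  have tail: "(\<Sum>i\<in>{n..<N}. a i \<odot> y i) \<in> Q n" if "\<And>i. norm (a i) \<le> 1" for a n N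
    using data(3) that by simp
  have shift: "k \<in> V (2 * \<rho> m)"
    if "m \<le> Suc n" "k \<in> B n" "t \<in> Q n" "k + t \<in> V (\<rho> m)" for n m k t
    using data(4) that by blast
  have sumM: "(\<Sum>i\<in>A. a i \<odot> y i) \<in> M" for a A
    by (intro subspace_sum[OF M(1)] subspace_scale[OF M(1)] y(1))
  \<comment> \<open>A combination in \<open>V (\<rho> 1)\<close> has its head through
    \<open>j\<close> in \<open>V (2 * \<rho> 1)\<close>, which is \<open>V (\<rho> 0)\<close>, and
    its head before \<open>j\<close> in \<open>V (2 * \<rho> 0)\<close>. The difference puts
    \<open>y j\<close> into \<open>V (3 * \<rho> 0)\<close>; as \<open>\<rho> 0\<close> is
    \<open>r / 4\<close>, this contradicts the choice of \<open>y j\<close> outside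
    \<open>V r\<close>.\<close>
  have below: "\<rho> 1 \<le> q (\<Sum>i<N. a i \<odot> y i)"
    if a: "\<And>i. norm (a i) \<le> 1" and j: "j < N" "norm (a j) = 1" for a j N
  proof (rule ccontr)
    assume "\<not> ?thesis"
    then have "(\<Sum>i<N. a i \<odot> y i) \<in> V (\<rho> 1)" using ball_in_V[OF sumM] by simp
    moreover have "(\<Sum>i<N. a i \<odot> y i) = (\<Sum>i<Suc j. a i \<odot> y i) + (\<Sum>i\<in>{Suc j..<N}. a i \<odot> y i)"
      using sum.atLeastLessThan_concat[of 0 "Suc j" N "\<lambda>i. a i \<odot> y i"] j(1)
      by (simp add: lessThan_atLeast0)
    ultimately have "(\<Sum>i<Suc j. a i \<odot> y i) \<in> V (2 * \<rho> 1)"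
      using shift[OF _ head[of a "Suc j", OF a] tail[of a "Suc j" N, OF a], of 1] by simp
    then have 1: "(\<Sum>i<j. a i \<odot> y i) + a j \<odot> y j \<in> V (\<rho> 0)" by (simp add: \<rho>_def)
    moreover have "a j \<odot> y j \<in> Q j" using tail[of a j "Suc j", OF a] by simp
    ultimately have "(\<Sum>i<j. a i \<odot> y i) \<in> V (2 * \<rho> 0)" using shift[OF _ head[of a j, OF a], of 0] by simp
    from V_diff[OF 1 this] have "a j \<odot> y j \<in> V (3 * \<rho> 0)" by simp
    then have "inverse (a j) \<odot> (a j \<odot> y j) \<in> V (3 * \<rho> 0)"
      by (rule V_scale[rotated]) (simp add: norm_inverse j(2))
    moreover have "a j \<noteq> 0" using j(2) by auto
    ultimately have "y j \<in> V (3 * \<rho> 0)" by simp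
    then have "y j \<in> V r" by (rule V_mono) (use r(1) in \<open>simp add: \<rho>_def\<close>)
    then show False using y(2) by blast
  qed
  have lim0: "g = 0"
    if fin: "\<And>k i. N k \<le> i \<Longrightarrow> a k i = 0"
      and small: "\<And>e. 0 < e \<Longrightarrow> \<exists>K. \<forall>k\<ge>K. \<forall>i. norm (a k i) < e"
      and g: "qlim (\<lambda>k. \<Sum>i<N k. a k i \<odot> y i) g" for a N g
  proof (rule V_all_imp_zero)
    fix e :: real assume e: "0 < e"
    define s where "s k = (\<Sum>i<N k. a k i \<odot> y i)" for k
    have ext: "s k = (\<Sum>i<n. a k i \<odot> y i)" if "N k \<le> n" for k n
      unfolding s_def by (rule sum.mono_neutral_left) (use that fin in auto)
    have g: "qlim s g" using g by (simp add: s_def)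
    have gM: "g \<in> M" by (rule qclosed_limit[OF M(2) _ g]) (simp add: s_def sumM)
    have "\<rho> \<longlonglongrightarrow> 0" unfolding \<rho>_def by (rule LIMSEQ_divide_realpow_zero) simp
    then obtain m where m: "3 * \<rho> m < e"
      using e \<rho> unfolding LIMSEQ_iff
      by (metis abs_of_pos diff_zero divide_pos_pos dual_order.refl less_divide_eq_numeral1(1)
          mult.commute real_norm_def zero_less_numeral)
    obtain K1 where K1: "\<And>k i. k \<ge> K1 \<Longrightarrow> norm (a k i) < 1" using small[of 1] by auto
    obtain K2 where K2: "\<And>k. k \<ge> K2 \<Longrightarrow> q (s k - g) < \<rho> m / 4"
      using g \<rho>[of m] unfolding qlim_iff by (metis divide_pos_pos zero_less_numeral)
    \<comment> \<open>First \<open>j\<close> is fixed with \<open>s j\<close> close to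
      \<open>g\<close>, then \<open>n\<close>, and only then a later \<open>k\<close> whose first
      \<open>n\<close> coefficients are negligible. So \<open>s k\<close> is close to
      \<open>s j\<close> and is almost a pure tail beyond \<open>n\<close>; \<open>shift\<close>
      removes that tail and leaves \<open>s j\<close> in \<open>V (2 * \<rho> m)\<close>.\<close>
    define j where "j = max K1 K2"
    \<comment> \<open>\<open>N j\<close> makes \<open>s j\<close> a head of length \<open>n\<close>,
      hence an element of \<open>B n\<close>; \<open>m\<close> makes the radius
      \<open>\<rho> m\<close> available at stage \<open>n\<close>.\<close>
    define n where "n = max (N j) m"
    have "qlim (\<lambda>k. a k i \<odot> y i) (0 \<odot> y i)" for i
    proof (rule qlim_scalars)
      show "(\<lambda>k. a k i) \<longlonglongrightarrow> 0" unfolding LIMSEQ_iff using small by (metis diff_zero)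
    qed
    then have "qlim (\<lambda>k. \<Sum>i<n. a k i \<odot> y i) 0"
    proof (induction n)
      case (Suc n)
      then show ?case using qlim_add[of _ 0 _ 0] by fastforce
    qed simp
    then obtain k where k: "k \<ge> j" "q (\<Sum>i<n. a k i \<odot> y i) < \<rho> m / 4"
      using \<rho>[of m] unfolding qlim_iff
      by (metis diff_zero divide_pos_pos nle_le zero_less_numeral)
    have "s k = (\<Sum>i<max n (N k). a k i \<odot> y i)" by (rule ext) simp
    also have "\<dots> = (\<Sum>i<n. a k i \<odot> y i) + (\<Sum>i\<in>{n..<max n (N k)}. a k i \<odot> y i)"
      using sum.atLeastLessThan_concat[of 0 n "max n (N k)" "\<lambda>i. a k i \<odot> y i"]
      by (simp add: lessThan_atLeast0)
    finally have sk: "s k = (\<Sum>i<n. a k i \<odot> y i) + (\<Sum>i\<in>{n..<max n (N k)}. a k i \<odot> y i)" .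
    define t where "t = (\<Sum>i\<in>{n..<max n (N k)}. - a k i \<odot> y i)"
    have le1: "norm (a k i) \<le> 1" "norm (a j i) \<le> 1" for i
      using K1[of k i] K1[of j i] k(1) by (auto simp: j_def less_imp_le)
    have "t \<in> Q n" unfolding t_def by (rule tail) (simp add: le1)
    have "s j \<in> B n" using ext[of j n] head[of "a j" n] le1(2) by (simp add: n_def)
    have t: "s j + t = (s j - s k) + (\<Sum>i<n. a k i \<odot> y i)"
      by (simp add: sk t_def sum_negf)
    have "q (s j - s k) < \<rho> m / 2"
      using q_diff_triangle[of "s j" "s k" g] K2[of j] K2[of k] k(1) q_diff_commute[of g "s k"]
      by (simp add: j_def)
    then have "q (s j + t) < \<rho> m"
      unfolding t using q_add[of "s j - s k" "\<Sum>i<n. a k i \<odot> y i"] k(2) \<rho>[of m] by linarith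
    moreover have "s j + t \<in> M"
      unfolding t by (intro subspace_add[OF M(1)] subspace_diff[OF M(1)]) (simp_all add: s_def sumM)
    ultimately have "s j + t \<in> V (\<rho> m)" by (intro ball_in_V)
    then have "s j \<in> V (2 * \<rho> m)"
      using shift[OF _ \<open>s j \<in> B n\<close> \<open>t \<in> Q n\<close>] by (simp add: n_def)
    moreover have "q (g - s j) < \<rho> m"
      using K2[of j] \<rho>[of m] q_diff_commute[of g "s j"] by (simp add: j_def)
    ultimately have "g \<in> V (2 * \<rho> m + \<rho> m)" using V_perturb gM by blast
    then show "g \<in> V e" by (rule V_mono) (use m in simp)
  qed
  show ?thesis by (rule that[of y "\<rho> 1", OF y(1) \<rho> below lim0])
qed

end

section \<open>Coordinates with respect to a sequence\<close>

context fnormed_space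
begin

text \<open>Coefficients defined on all of \<open>nat\<close> allow combinations of different
  lengths to be subtracted and passed to a limit. Keeping track of \<open>I\<close> covers the spans
  of initial segments as well.\<close>

lemma span_image_combination:
  fixes z :: "nat \<Rightarrow> 'e"
  assumes "v \<in> span (z ` I)"
  shows "\<exists>a N. (\<forall>i. a i \<noteq> 0 \<longrightarrow> i \<in> I \<and> i < N) \<and> v = (\<Sum>i<N. a i \<odot> z i)"
  using assms
proof (induction rule: span_induct_alt)
  case base
  then show ?case by (intro exI[of _ "\<lambda>_. 0"] exI[of _ 0]) simp
next
  case (step c x y)
  then obtain m where m: "m \<in> I" "x = z m" by blast
  from step obtain a N where a: "\<And>i. a i \<noteq> 0 \<Longrightarrow> i \<in> I \<and> i < N" "y = (\<Sum>i<N. a i \<odot> z i)" by blast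
  define b where "b i = a i + (if i = m then c else 0)" for i
  define K where "K = max N (Suc m)"
  have "(\<Sum>i<K. b i \<odot> z i) = (\<Sum>i<K. a i \<odot> z i) + (\<Sum>i<K. (if i = m then c else 0) \<odot> z i)"
    by (simp add: b_def scale_left_distrib sum.distrib)
  also have "(\<Sum>i<K. a i \<odot> z i) = y"
    unfolding a(2)
  proof (rule sum.mono_neutral_right)
    show "\<forall>i\<in>{..<K} - {..<N}. a i \<odot> z i = 0"
    proof
      fix i assume "i \<in> {..<K} - {..<N}"
      then have "a i = 0" using a(1)[of i] by auto
      then show "a i \<odot> z i = 0" by simp
    qed
  qed (auto simp: K_def)
  also have "(\<Sum>i<K. (if i = m then c else 0) \<odot> z i) = (\<Sum>i<K. if i = m then c \<odot> x else 0)"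
    by (intro sum.cong) (auto simp: m(2))
  also have "\<dots> = c \<odot> x"
    by (simp add: K_def less_max_iff_disj)
  finally have "c \<odot> x + y = (\<Sum>i<K. b i \<odot> z i)" by (simp add: add.commute)
  moreover have "i \<in> I \<and> i < K" if "b i \<noteq> 0" for i
  proof (cases "i = m")
    case True
    then show ?thesis using m(1) by (simp add: K_def)
  next
    case False
    then have "a i \<noteq> 0" using that by (simp add: b_def)
    then show ?thesis using a(1)[of i] by (auto simp: K_def)
  qed
  ultimately show ?case by blast
qed

text \<open>\<open>coordinate_small\<close> is applied to a coefficient of largest modulus: after
  division by it all coefficients have modulus at most one, as the lower bound requires, and it
  dominates all others.\<close>

lemma coordinates_small:
  fixes z :: "nat \<Rightarrow> 'e"
  assumes d: "0 < d"
    "\<And>a j N. \<lbrakk>\<And>i. norm (a i) \<le> 1; j < N; norm (a j) = 1\<rbrakk> \<Longrightarrow> d \<le> q (\<Sum>i<N. a i \<odot> z i)"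
    and e: "0 < e"
  shows "\<exists>h>0. \<forall>a N i. (\<forall>i\<ge>N. a i = 0) \<longrightarrow> q (\<Sum>i<N. a i \<odot> z i) < h \<longrightarrow> norm (a i) < e"
proof -
  define P where "P v c \<longleftrightarrow> (\<exists>a N j. v = (\<Sum>i<N. a i \<odot> z i) \<and> j < N \<and> c = a j \<and>
    (\<forall>i. norm (a i) \<le> norm (a j)))" for v c
  have "\<exists>h>0. \<forall>v c. P v c \<longrightarrow> q v < h \<longrightarrow> norm c < e"
  proof (rule coordinate_small[OF d(1) _ _ e])
    show "d \<le> q v" if v: "P v c" "norm c = 1" for v c
    proof -
      obtain a N j where a: "v = (\<Sum>i<N. a i \<odot> z i)" "j < N" "c = a j" "\<And>i. norm (a i) \<le> norm (a j)"
        using v(1) unfolding P_def by blast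
      show ?thesis unfolding a(1) by (rule d(2)[of a j]) (use a v(2) in auto)
    qed
    show "P (inverse c \<odot> v) 1" if v: "P v c" "0 < norm c" for v c
    proof -
      obtain a N j where a: "v = (\<Sum>i<N. a i \<odot> z i)" "j < N" "c = a j" "\<And>i. norm (a i) \<le> norm (a j)"
        using v(1) unfolding P_def by blast
      have "inverse c \<odot> v = (\<Sum>i<N. (inverse c * a i) \<odot> z i)"
        by (simp add: a(1) scale_sum_right)
      moreover have "inverse c * a j = 1" using a(3) v(2) by simp
      moreover have "norm (inverse c * a i) \<le> norm (inverse c * a j)" for i
        using a(4)[of i] by (simp add: norm_mult mult_left_mono)
      ultimately show ?thesis unfolding P_def using a(2)
        by (rule_tac exI[of _ "\<lambda>i. inverse c * a i"], rule_tac exI[of _ N], rule_tac exI[of _ j]) simp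
    qed
  qed
  then obtain h where h: "0 < h" "\<And>v c. P v c \<Longrightarrow> q v < h \<Longrightarrow> norm c < e" by blast
  have "norm (a i) < e" if a: "\<And>i. N \<le> i \<Longrightarrow> a i = 0" "q (\<Sum>i<N. a i \<odot> z i) < h" for a N i
  proof (cases "a i = 0")
    case False
    then obtain n where n: "a n \<noteq> 0" "\<And>i. norm (a i) \<le> norm (a n)"
      using c_null_max[OF c_null_finite_support[of N a]] a(1) by metis
    then have "n < N" using a(1) by (meson not_less)
    then have "P (\<Sum>i<N. a i \<odot> z i) (a n)" unfolding P_def using n(2) by blast
    from h(2)[OF this a(2)] n(2)[of i] show ?thesis by simp
  qed (use e in simp)
  with h(1) show ?thesis by blast
qed

text \<open>The bound is uniform in the length \<open>N\<close>: summability controls the tail once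
  the coefficients have modulus at most one, and only the finitely many terms before
  \<open>m\<close> restrict \<open>d\<close> further.\<close>

lemma small_combinations:
  assumes s: "summable (\<lambda>n. q (x n))" and e: "0 < e"
  obtains d where "0 < d"
    "\<And>b N. (\<And>i. norm (b i) < d) \<Longrightarrow> q (\<Sum>i<N. b i \<odot> x i) < e"
proof -
  obtain m where m: "\<And>n. norm (\<Sum>i\<in>{m..<n}. q (x i)) < e / 2"
    using s e unfolding summable_Cauchy by (meson half_gt_zero order_refl)
  \<comment> \<open>\<open>Suc m\<close> excludes division by zero and keeps the sum of
    \<open>m\<close> terms strictly below \<open>e / 2\<close>.\<close>
  define h where "h = e / (2 * real (Suc m))"
  have "0 < h" using e by (simp add: h_def)
  have "\<exists>f. \<forall>i. 0 < f i \<and> (\<forall>c. norm c < f i \<longrightarrow> q (c \<odot> x i) < h)"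
    by (rule choice) (use q_scale_small[OF \<open>0 < h\<close>] in blast)
  then obtain f where f: "\<And>i. 0 < f i" "\<And>i c. norm c < f i \<Longrightarrow> q (c \<odot> x i) < h" by blast
  define d where "d = Min (insert 1 (f ` {..<m}))"
  have dpos: "0 < d" using f(1) by (simp add: d_def)
  have df: "d \<le> f i" if "i < m" for i using that by (simp add: d_def)
  have d1: "d \<le> 1" by (simp add: d_def)
  have "q (\<Sum>i<N. b i \<odot> x i) < e" if b: "\<And>i. norm (b i) < d" for b N
  proof -
    have "q (\<Sum>i<N. b i \<odot> x i) \<le> (\<Sum>i<N. q (b i \<odot> x i))" by (rule q_sum)
    also have "\<dots> \<le> (\<Sum>i\<in>{..<m} \<union> {m..<N}. q (b i \<odot> x i))" by (rule sum_mono2) auto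
    also have "\<dots> = (\<Sum>i<m. q (b i \<odot> x i)) + (\<Sum>i\<in>{m..<N}. q (b i \<odot> x i))"
      by (rule sum.union_disjoint) auto
    also have "\<dots> \<le> (\<Sum>i<m. h) + (\<Sum>i\<in>{m..<N}. q (x i))"
    proof (intro add_mono sum_mono)
      fix i assume "i \<in> {..<m}"
      then show "q (b i \<odot> x i) \<le> h" using f(2)[of "b i" i] b[of i] df[of i] by fastforce
    next
      fix i show "q (b i \<odot> x i) \<le> q (x i)" using b[of i] d1 by (intro q_scale_le) linarith
    qed
    also have "(\<Sum>i<m. h) < e / 2" using e by (simp add: h_def field_simps)
    finally show ?thesis using m[of N] by simp
  qed
  with dpos that show ?thesis by blast
qed

text \<open>This is completeness of the null sequences in the supremum norm, for finitely supported
  approximants.\<close>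

lemma uniform_limit_coordinates:
  fixes a :: "nat \<Rightarrow> nat \<Rightarrow> 'k"
  assumes fin: "\<And>k i. N k \<le> i \<Longrightarrow> a k i = 0"
    and Cauchy: "\<And>e. 0 < e \<Longrightarrow> \<exists>K. \<forall>k\<ge>K. \<forall>l\<ge>K. \<forall>i. norm (a k i - a l i) < e"
  obtains b where "b \<in> c_null" "\<And>e. 0 < e \<Longrightarrow> \<exists>K. \<forall>k\<ge>K. \<forall>i. norm (a k i - b i) < e"
proof -
  have "Cauchy (\<lambda>k. a k i)" for i
    unfolding Cauchy_iff using Cauchy by meson
  then have "\<exists>b. \<forall>i. (\<lambda>k. a k i) \<longlonglongrightarrow> b i"
    by (intro choice allI) (simp add: Cauchy_convergent_iff convergent_def)
  then obtain b where b: "\<And>i. (\<lambda>k. a k i) \<longlonglongrightarrow> b i" by blast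
  have unif: "\<exists>K. \<forall>k\<ge>K. \<forall>i. norm (a k i - b i) < e" if e: "0 < e" for e
  proof -
    obtain K where K: "\<And>k l i. \<lbrakk>k \<ge> K; l \<ge> K\<rbrakk> \<Longrightarrow> norm (a k i - a l i) < e / 2"
      using Cauchy[of "e / 2"] e by auto
    have "norm (a k i - b i) \<le> e / 2" if "k \<ge> K" for k i
    proof (rule LIMSEQ_le_const2)
      show "(\<lambda>l. norm (a k i - a l i)) \<longlonglongrightarrow> norm (a k i - b i)"
        by (intro tendsto_intros b)
      show "\<exists>M. \<forall>l\<ge>M. norm (a k i - a l i) \<le> e / 2"
        using K[OF that] less_imp_le by blast
    qed
    moreover have "e / 2 < e" using e by simp
    ultimately show ?thesis by (meson le_less_trans)
  qed
  have "b \<longlonglongrightarrow> 0"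
    unfolding LIMSEQ_iff
  proof (intro allI impI)
    fix e :: real assume "0 < e"
    then obtain K where K: "\<And>i. norm (a K i - b i) < e" using unif by blast
    show "\<exists>n. \<forall>i\<ge>n. norm (b i - 0) < e"
      using K fin[of K] by (metis diff_0 diff_zero norm_minus_cancel)
  qed
  then have "b \<in> c_null" by (simp add: c_null_def)
  then show ?thesis using unif that by blast
qed

end

section \<open>A closed span that meets the given subspace only in zero\<close>

context weak_nbhd_base
begin

text \<open>The witness is \<open>z n = y n + \<epsilon> n x n\<close> with \<open>y\<close> from the previous lemma and small \<open>\<epsilon> n\<close>:
  modulo \<open>M\<close> an element of the closed span is a combination of the \<open>x n\<close>, so it lies in \<open>W\<close>
  only if all its coordinates vanish.\<close>

theorem ex_closed_subspace_avoiding: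
  assumes W: "subspace W" "M \<subseteq> W" and x: "c0_independent_mod W x"
  obtains z :: "nat \<Rightarrow> 'e" where "\<And>n. z n \<notin> span (z ` {..<n})" "qcl (span (range z)) \<inter> W \<subseteq> {0}"
proof (rule ex_basic_sequence)
  fix y :: "nat \<Rightarrow> 'e" and d :: real
  assume y: "\<And>n. y n \<in> M" and d: "0 < d"
    and below: "\<And>a j N. \<lbrakk>\<And>i. norm (a i) \<le> 1; j < N; norm (a j) = 1\<rbrakk> \<Longrightarrow> d \<le> q (\<Sum>i<N. a i \<odot> y i)"
    and lim0: "\<And>a N g. \<lbrakk>\<And>k i. N k \<le> i \<Longrightarrow> a k i = 0;
      \<And>e. 0 < e \<Longrightarrow> \<exists>K. \<forall>k\<ge>K. \<forall>i. norm (a k i) < e;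
      qlim (\<lambda>k. \<Sum>i<N k. a k i \<odot> y i) g\<rbrakk> \<Longrightarrow> g = 0"
  \<comment> \<open>The perturbations add up to at most \<open>2 * D 0\<close>, that is
    \<open>d / 2\<close>, so \<open>z\<close> keeps half of the lower bound of
    \<open>y\<close>.\<close>
  define D where "D n = d / 4 / 2 ^ n" for n :: nat
  have D: "0 < D n" "D (Suc n) \<le> D n / 2" for n using d by (simp_all add: D_def)
  have "\<exists>\<epsilon>. \<forall>n. \<epsilon> n \<noteq> 0 \<and> norm (\<epsilon> n) \<le> 1 \<and> q (\<epsilon> n \<odot> x n) < D n"
  proof (rule choice, rule allI)
    fix n
    show "\<exists>t. t \<noteq> 0 \<and> norm t \<le> 1 \<and> q (t \<odot> x n) < D n"
      by (rule small_nonzero_multiple[OF D(1)[of n], of "x n"]) blast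
  qed
  then obtain \<epsilon> where \<epsilon>: "\<And>n. \<epsilon> n \<noteq> 0" "\<And>n. norm (\<epsilon> n) \<le> 1" "\<And>n. q (\<epsilon> n \<odot> x n) < D n" by blast
  define x' where "x' n = \<epsilon> n \<odot> x n" for n
  have x'D: "q (x' n) \<le> D n" for n using \<epsilon>(3)[of n] by (simp add: x'_def)
  note halving = summable_le_halving[of "\<lambda>n. q (x' n)" D, OF q_nonneg x'D D(2)]
  have x'_small: "q (\<Sum>i<N. a i \<odot> x' i) \<le> d / 2" if a: "\<And>i. norm (a i) \<le> 1" for a N
  proof -
    have "q (\<Sum>i<N. a i \<odot> x' i) \<le> (\<Sum>i<N. q (x' i))"
      by (rule order_trans[OF q_sum]) (intro sum_mono q_scale_le a)
    also have "\<dots> \<le> 2 * D 0" using halving(2)[of 0 N] by (simp add: lessThan_atLeast0)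
    finally show ?thesis by (simp add: D_def)
  qed
  define z where "z n = y n + x' n" for n
  have zsum: "(\<Sum>i<N. a i \<odot> z i) = (\<Sum>i<N. a i \<odot> y i) + (\<Sum>i<N. a i \<odot> x' i)" for a N
    by (simp add: z_def scale_right_distrib sum.distrib)
  have zbelow: "d / 2 \<le> q (\<Sum>i<N. a i \<odot> z i)"
    if a: "\<And>i. norm (a i) \<le> 1" "j < N" "norm (a j) = 1" for a j N
  proof -
    have "d \<le> q ((\<Sum>i<N. a i \<odot> z i) - (\<Sum>i<N. a i \<odot> x' i))"
      using below[of a j N, OF a] by (simp add: zsum)
    also have "\<dots> \<le> q (\<Sum>i<N. a i \<odot> z i) + d / 2"
      using q_diff x'_small[OF a(1)] by (meson add_left_mono order_trans)
    finally show ?thesis by simp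
  qed
  have d2: "0 < d / 2" using d by simp
  have small: "\<exists>h>0. \<forall>a N i. (\<forall>i\<ge>N. a i = 0) \<longrightarrow> q (\<Sum>i<N. a i \<odot> z i) < h \<longrightarrow> norm (a i) < e"
    if "0 < e" for e
    by (rule coordinates_small[OF d2 zbelow that])
  have indep: "z n \<notin> span (z ` {..<n})" for n
  proof
    assume "z n \<in> span (z ` {..<n})"
    then obtain a N where a: "\<And>i. a i \<noteq> 0 \<Longrightarrow> i < n \<and> i < N" "z n = (\<Sum>i<N. a i \<odot> z i)"
      using span_image_combination[of "z n" z "{..<n}"] by auto
    obtain h where h: "0 < h"
      "\<And>a N i. \<lbrakk>\<forall>i\<ge>N. a i = 0; q (\<Sum>i<N. a i \<odot> z i) < h\<rbrakk> \<Longrightarrow> norm (a i) < 1"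
      using small[of 1] by auto
    define b where "b = (\<lambda>i. if i = n then 1 else - a i)"
    have "(\<Sum>i<N. a i \<odot> z i) = (\<Sum>i<n. a i \<odot> z i)"
    proof (rule sum.mono_neutral_cong)
      show "a i \<odot> z i = 0" if "i \<in> {..<n} - {..<N}" for i
        using a(1)[of i] that by (cases "a i = 0") auto
      show "a i \<odot> z i = 0" if "i \<in> {..<N} - {..<n}" for i
        using a(1)[of i] that by (cases "a i = 0") auto
    qed auto
    then have "(\<Sum>i<Suc n. b i \<odot> z i) = 0"
      using a(2) by (simp add: b_def sum_negf)
    moreover have "b i = 0" if "i \<ge> Suc n" for i using a(1)[of i] that by (auto simp: b_def)
    ultimately have "norm (b n) < 1" using h(2)[of "Suc n" b n] h(1) by simp
    then show False by (simp add: b_def)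
  qed
  have "g = 0" if gcl: "g \<in> qcl (span (range z))" and gW: "g \<in> W" for g
  proof -
    obtain s where s: "\<And>k. s k \<in> span (range z)" "qlim s g" using qclE[OF gcl] by blast
    have "\<forall>k. \<exists>p. (\<forall>i\<ge>snd p. fst p i = 0) \<and> s k = (\<Sum>i<snd p. fst p i \<odot> z i)"
    proof
      fix k
      obtain a N where "\<And>i. a i \<noteq> 0 \<Longrightarrow> i < N" "s k = (\<Sum>i<N. a i \<odot> z i)"
        using span_image_combination[of "s k" z UNIV] s(1)[of k] by auto
      then show "\<exists>p. (\<forall>i\<ge>snd p. fst p i = 0) \<and> s k = (\<Sum>i<snd p. fst p i \<odot> z i)"
        by (intro exI[of _ "(a, N)"]) force
    qed
    then obtain p where p: "\<And>k i. i \<ge> snd (p k) \<Longrightarrow> fst (p k) i = 0"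
      "\<And>k. s k = (\<Sum>i<snd (p k). fst (p k) i \<odot> z i)" by metis
    define a where "a k = fst (p k)" for k
    define N where "N k = snd (p k)" for k
    have fin: "\<And>k i. N k \<le> i \<Longrightarrow> a k i = 0" and sk: "\<And>k. s k = (\<Sum>i<N k. a k i \<odot> z i)"
      using p by (simp_all add: a_def N_def)
    have ext: "(\<Sum>i<N k. a k i \<odot> w i) = (\<Sum>i<n. a k i \<odot> w i)" if "N k \<le> n" for k n w
      by (rule sum.mono_neutral_left) (use that fin in auto)
    have Cauchy: "\<exists>K. \<forall>k\<ge>K. \<forall>l\<ge>K. \<forall>i. norm (a k i - a l i) < e" if e: "0 < e" for e
    proof -
      obtain h where h: "0 < h"
        "\<And>a N i. \<lbrakk>\<forall>i\<ge>N. a i = 0; q (\<Sum>i<N. a i \<odot> z i) < h\<rbrakk> \<Longrightarrow> norm (a i) < e"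
        using small[OF e] by auto
      obtain K where K: "\<And>k. k \<ge> K \<Longrightarrow> q (s k - g) < h / 2"
        using s(2) h(1) unfolding qlim_iff by (meson half_gt_zero)
      have "norm (a k i - a l i) < e" if kl: "k \<ge> K" "l \<ge> K" for k l i
      proof (rule h(2)[of "max (N k) (N l)" "\<lambda>i. a k i - a l i"])
        show "\<forall>i\<ge>max (N k) (N l). a k i - a l i = 0" using fin by simp
        have "(\<Sum>i<max (N k) (N l). (a k i - a l i) \<odot> z i) = s k - s l"
          unfolding sk by (simp add: scale_left_diff_distrib sum_subtractf
              ext[of k "max (N k) (N l)"] ext[of l "max (N k) (N l)"])
        then show "q (\<Sum>i<max (N k) (N l). (a k i - a l i) \<odot> z i) < h"
          using q_diff_triangle[of "s k" "s l" g] K[OF kl(1)] K[OF kl(2)]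
            q_diff_commute[of g "s l"] by simp
      qed
      then show ?thesis by blast
    qed
    obtain b where b: "b \<in> c_null" "\<And>e. 0 < e \<Longrightarrow> \<exists>K. \<forall>k\<ge>K. \<forall>i. norm (a k i - b i) < e"
      using uniform_limit_coordinates[OF fin Cauchy] by blast
    \<comment> \<open>The independence hypothesis concerns \<open>x\<close>, not \<open>x'\<close>,
      so the factors \<open>\<epsilon> n\<close> move into the coefficients; their modulus of at
      most one keeps these null.\<close>
    have "(\<lambda>n. b n * \<epsilon> n) \<in> c_null"
    proof -
      have "norm (b n * \<epsilon> n) \<le> norm (b n)" for n
        using \<epsilon>(2)[of n] by (simp add: norm_mult mult_left_le)
      moreover have "(\<lambda>n. norm (b n)) \<longlonglongrightarrow> 0"
        using b(1) tendsto_norm_zero by (auto simp: c_null_def)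
      ultimately show ?thesis
        unfolding c_null_def by (auto intro!: Lim_null_comparison[where g = "\<lambda>n. norm (b n)"])
    qed
    from bspec[OF x[unfolded c0_independent_mod_def] this]
    obtain l where l: "qlim (\<lambda>N. \<Sum>i<N. (b i * \<epsilon> i) \<odot> x i) l"
      "l \<in> W \<longrightarrow> (\<forall>i. b i * \<epsilon> i = 0)" by blast
    have l': "qlim (\<lambda>N. \<Sum>i<N. b i \<odot> x' i) l" using l(1) by (simp add: x'_def)
    define L where "L k = (\<Sum>i<N k. a k i \<odot> x' i)" for k
    have "qlim L l"
      unfolding qlim_iff
    proof (intro allI impI)
      fix e :: real assume e: "0 < e"
      obtain h where h: "0 < h" "\<And>c N. (\<And>i. norm (c i) < h) \<Longrightarrow> q (\<Sum>i<N. c i \<odot> x' i) < e / 2"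
        using small_combinations[OF halving(1), of "e / 2"] e by auto
      obtain K where K: "\<And>k i. k \<ge> K \<Longrightarrow> norm (a k i - b i) < h" using b(2)[OF h(1)] by blast
      have "q (L k - l) < e" if k: "k \<ge> K" for k
      \<comment> \<open>The truncation index may depend on \<open>k\<close>, because the estimate
        from \<open>small_combinations\<close> does not depend on the length of the
        combination.\<close>
      proof -
        obtain m where m: "\<And>n. n \<ge> m \<Longrightarrow> q ((\<Sum>i<n. b i \<odot> x' i) - l) < e / 2"
          using l' e unfolding qlim_iff by (meson half_gt_zero)
        define n where "n = max m (N k)"
        have "L k - (\<Sum>i<n. b i \<odot> x' i) = (\<Sum>i<n. (a k i - b i) \<odot> x' i)"
          unfolding L_def by (simp add: ext[of k n] n_def scale_left_diff_distrib sum_subtractf)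
        then have "q (L k - (\<Sum>i<n. b i \<odot> x' i)) < e / 2" 
          using h(2)[of "\<lambda>i. a k i - b i" n] K[OF k] by simp
        moreover have "q ((\<Sum>i<n. b i \<odot> x' i) - l) < e / 2" by (rule m) (simp add: n_def)
        ultimately show ?thesis
          using q_diff_triangle[of "L k" l "\<Sum>i<n. b i \<odot> x' i"] by linarith
      qed
      then show "\<exists>K. \<forall>k\<ge>K. q (L k - l) < e" by blast
    qed
    \<comment> \<open>Only \<open>y\<close>-parts remain, so \<open>g - l\<close> lies in
      \<open>M\<close> and \<open>l\<close> in \<open>W\<close>, which forces \<open>b = 0\<close>
      and \<open>l = 0\<close>. Then \<open>g\<close> is a limit of \<open>y\<close>-combinations
      with coefficients tending uniformly to zero, the case settled by \<open>lim0\<close>.\<close>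
    then have lim: "qlim (\<lambda>k. s k - L k) (g - l)" by (rule qlim_diff[OF s(2)])
    have sL: "s k - L k = (\<Sum>i<N k. a k i \<odot> y i)" for k
      by (simp add: sk zsum L_def)
    have "g - l \<in> M"
      by (rule qclosed_limit[OF M(2) _ lim])
        (simp add: sL subspace_sum[OF M(1)] subspace_scale[OF M(1)] y)
    then have "g - (g - l) \<in> W" using subspace_diff[OF W(1) gW] W(2) by blast
    then have b0: "b i = 0" for i using l(2) \<epsilon>(1)[of i] by auto
    then have "qlim (\<lambda>N. 0) l" using l' by simp
    then have "l = 0" using qlim_unique[OF _ qlim_const[of 0]] by simp
    with lim have "qlim (\<lambda>k. \<Sum>i<N k. a k i \<odot> y i) g" by (simp add: sL)
    then show "g = 0" 
      using lim0[of N a g] fin b(2) by (simp add: b0)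
  qed
  then show thesis using that[of z] indep by blast
qed

end

section \<open>Closed subspaces of dimension continuum\<close>

text \<open>Vandermonde independence without determinants: vanishing power sums annihilate every
  polynomial, in particular the product that vanishes at all nodes except
  \<open>g t\<close>.\<close>

lemma power_sums_eq_0:
  fixes u g :: "'a \<Rightarrow> 'k::field"
  assumes S: "finite S" "inj_on g S" and zero: "\<And>n. (\<Sum>s\<in>S. u s * g s ^ n) = 0" and "t \<in> S"
  shows "u t = 0"
proof -
  define p where "p = (\<Prod>s\<in>S - {t}. [:- g s, 1:])"
  have p: "poly p (g s) = (\<Prod>r\<in>S - {t}. g s - g r)" for s
    by (simp add: p_def poly_prod)
  have "(\<Sum>s\<in>S. u s * poly p (g s)) = (\<Sum>s\<in>S. \<Sum>i\<le>degree p. coeff p i * (u s * g s ^ i))"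
    by (simp add: poly_altdef sum_distrib_left mult_ac)
  also have "\<dots> = (\<Sum>i\<le>degree p. coeff p i * (\<Sum>s\<in>S. u s * g s ^ i))"
    by (subst sum.swap) (simp add: sum_distrib_left)
  also have "\<dots> = 0" by (simp add: zero)
  finally have "(\<Sum>s\<in>S. u s * poly p (g s)) = 0" .
  moreover have "(\<Sum>s\<in>S. u s * poly p (g s)) = (\<Sum>s\<in>{t}. u s * poly p (g s))"
  proof (rule sum.mono_neutral_right)
    show "\<forall>s\<in>S - {t}. u s * poly p (g s) = 0" using S(1) by (auto simp: p)
  qed (use S \<open>t \<in> S\<close> in auto)
  moreover have "poly p (g t) \<noteq> 0"
    using S \<open>t \<in> S\<close> by (auto simp: p dest: inj_onD)
  ultimately show ?thesis by simp
qed

text \<open>The type describes sequences of finite combinations, by coefficients and length. With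
  scalars coded as subsets of \<open>nat\<close>, a whole sequence becomes one subset of a countable
  type.\<close>

lemma sequences_lepoll_real:
  assumes "(UNIV :: 'k set) \<lesssim> (UNIV :: real set)"
  shows "(UNIV :: (nat \<Rightarrow> (nat \<Rightarrow> 'k) \<times> nat) set) \<lesssim> (UNIV :: real set)"
proof -
  have "(UNIV :: 'k set) \<lesssim> (UNIV :: nat set set)"
    using lepoll_trans2[OF assms eqpoll_sym[OF nat_sets_eqpoll_reals]] .
  then obtain g :: "'k \<Rightarrow> nat set" where g: "inj g" unfolding lepoll_def by blast
  define J :: "(nat \<Rightarrow> (nat \<Rightarrow> 'k) \<times> nat) \<Rightarrow> nat set" where
    "J f = to_nat ` ({(k, i, m). m \<in> g (fst (f k) i)} <+> {(k, n). n = snd (f k)})" for f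
  have "inj J"
  proof (rule injI)
    fix f h assume "J f = J h"
    then have eq: "{(k, i, m). m \<in> g (fst (f k) i)} <+> {(k, n). n = snd (f k)}
        = {(k, i, m). m \<in> g (fst (h k) i)} <+> {(k, n). n = snd (h k)}"
      unfolding J_def by (simp add: inj_image_eq_iff)
    show "f = h"
    proof
      fix k
      have "m \<in> g (fst (f k) i) \<longleftrightarrow> m \<in> g (fst (h k) i)" for i m
        using arg_cong[OF eq, of "\<lambda>S. Inl (k, i, m) \<in> S"] by (auto simp: Plus_def)
      then have "fst (f k) i = fst (h k) i" for i
        using g by (intro injD[OF g] set_eqI)
      moreover have "snd (f k) = snd (h k)"
        using arg_cong[OF eq, of "\<lambda>S. Inr (k, snd (f k)) \<in> S"] by (auto simp: Plus_def)
      ultimately show "f k = h k" by (auto intro: prod_eqI)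
    qed
  qed
  then have "(UNIV :: (nat \<Rightarrow> (nat \<Rightarrow> 'k) \<times> nat) set) \<lesssim> (UNIV :: nat set set)"
    unfolding lepoll_def by blast
  then show ?thesis using lepoll_trans2 nat_sets_eqpoll_reals by blast
qed

context fnormed_space
begin

text \<open>A point of the closed span is determined by any sequence of finite combinations
  converging to it, and there are at most continuum many such sequences.\<close>

lemma qcl_span_countable_lepoll:
  assumes "(UNIV :: 'k set) \<lesssim> (UNIV :: real set)" "countable Z"
  shows "qcl (span Z) \<lesssim> (UNIV :: real set)"
proof -
  obtain z :: "nat \<Rightarrow> 'e" where z: "Z \<subseteq> range z"
    using assms(2) by (metis countable_subset_image from_nat_into_surj subsetI rangeI)
  \<comment> \<open>The value is arbitrary where the combinations diverge; it matters only that the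
    range covers the closed span.\<close>
  define \<Phi> where "\<Phi> f = (SOME x. qlim (\<lambda>k. \<Sum>i<snd (f k). fst (f k) i \<odot> z i) x)"
    for f :: "nat \<Rightarrow> (nat \<Rightarrow> 'k) \<times> nat"
  have "qcl (span Z) \<subseteq> range \<Phi>"
  proof
    fix x assume "x \<in> qcl (span Z)"
    then have "x \<in> qcl (span (range z))" using qcl_mono[OF span_mono[OF z]] by blast
    then obtain s where s: "\<And>k. s k \<in> span (range z)" "qlim s x" by (rule qclE) blast
    have "\<exists>p. s k = (\<Sum>i<snd p. fst p i \<odot> z i)" for k
    proof -
      obtain a N where "s k = (\<Sum>i<N. a i \<odot> z i)"
        using span_image_combination[of "s k" z UNIV] s(1)[of k] by auto
      then show ?thesis by (intro exI[of _ "(a, N)"]) simp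
    qed
    then have "\<exists>f. \<forall>k. s k = (\<Sum>i<snd (f k). fst (f k) i \<odot> z i)" by (intro choice allI)
    then obtain f where f: "\<And>k. s k = (\<Sum>i<snd (f k). fst (f k) i \<odot> z i)" by blast
    have lim: "qlim (\<lambda>k. \<Sum>i<snd (f k). fst (f k) i \<odot> z i) x" using s(2) by (simp only: f)
    have "qlim (\<lambda>k. \<Sum>i<snd (f k). fst (f k) i \<odot> z i) (\<Phi> f)"
      unfolding \<Phi>_def by (rule someI[where P = "qlim (\<lambda>k. \<Sum>i<snd (f k). fst (f k) i \<odot> z i)", OF lim])
    then have "x = \<Phi> f" by (rule qlim_unique[OF lim])
    then show "x \<in> range \<Phi>" by blast
  qed
  then have "qcl (span Z) \<lesssim> (UNIV :: (nat \<Rightarrow> (nat \<Rightarrow> 'k) \<times> nat) set)"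
    by (rule subset_image_lepoll)
  then show ?thesis using sequences_lepoll_real[OF assms(1)] lepoll_trans by blast
qed

text \<open>The geometric sequences with ratio in \<open>(0, 1)\<close> are linearly independent in the null
  sequences, and \<open>c \<mapsto> \<Sum>n. c n \<odot> x n\<close> is injective and linear.\<close>

lemma ex_independent_continuum:
  assumes x: "c0_independent_mod {0} x"
    and F: "\<And>c l. qlim (\<lambda>N. \<Sum>n<N. c n \<odot> x n) l \<Longrightarrow> l \<in> F"
  obtains C where "independent C" "C \<subseteq> F" "C \<approx> (UNIV :: real set)"
proof -
  let ?I = "{0<..<1::real}"
  define g where "g t n = (of_real t ^ Suc n :: 'k)" for t n
  have g: "g t \<in> c_null" if "t \<in> ?I" for t
  proof -
    have "(\<lambda>n. of_real t ^ n :: 'k) \<longlonglongrightarrow> 0" using that by (intro LIMSEQ_power_zero) simp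
    from LIMSEQ_Suc[OF this] show ?thesis 
      unfolding c_null_def mem_Collect_eq g_def[abs_def] .
  qed
  define T where "T t = (SOME l. qlim (\<lambda>N. \<Sum>n<N. g t n \<odot> x n) l)" for t
  have T: "qlim (\<lambda>N. \<Sum>n<N. g t n \<odot> x n) (T t)" if "t \<in> ?I" for t
    unfolding T_def by (rule someI_ex) (use x g[OF that] in \<open>auto simp: c0_independent_mod_def\<close>)
  have zero: "u t = 0"
    if S: "finite S" "S \<subseteq> ?I" and u: "(\<Sum>t\<in>S. u t \<odot> T t) = 0" and t: "t \<in> S" for S u t
  proof -
    define c where "c n = (\<Sum>s\<in>S. u s * g s n)" for n
    have "c \<longlonglongrightarrow> (\<Sum>s\<in>S. u s * 0)"
      unfolding c_def using g S(2) by (intro tendsto_intros) (auto simp: c_null_def)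
    then have c: "c \<in> c_null" by (simp add: c_null_def)
    have "qlim (\<lambda>N. \<Sum>s\<in>S. u s \<odot> (\<Sum>n<N. g s n \<odot> x n)) (\<Sum>s\<in>S. u s \<odot> T s)"
      using S
    proof (induction S rule: finite_induct)
      case (insert r S)
      then show ?case
        using qlim_add[OF qlim_scale[OF T[of r], of "u r"]] by simp
    qed simp
    moreover have "(\<Sum>s\<in>S. u s \<odot> (\<Sum>n<N. g s n \<odot> x n)) = (\<Sum>n<N. c n \<odot> x n)" for N
      unfolding c_def by (simp add: scale_sum_right scale_sum_left sum.swap[of _ S])
    ultimately have lim: "qlim (\<lambda>N. \<Sum>n<N. c n \<odot> x n) 0" by (simp add: u)
    obtain l where l: "qlim (\<lambda>N. \<Sum>n<N. c n \<odot> x n) l" "l \<in> {0} \<longrightarrow> (\<forall>n. c n = 0)"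
      using x c unfolding c0_independent_mod_def by blast
    then have c0: "c n = 0" for n using qlim_unique[OF l(1) lim] by simp
    \<comment> \<open>The exponent \<open>Suc n\<close> in \<open>g\<close> leaves one factor
      \<open>t\<close>, which joins the coefficient and is nonzero because the interval is open at
      zero.\<close>
    have "u t * of_real t = 0"
    proof (rule power_sums_eq_0[OF S(1) _ _ t, of of_real])
      show "inj_on (of_real :: real \<Rightarrow> 'k) S" by (simp add: inj_on_def)
      show "(\<Sum>s\<in>S. u s * of_real s * of_real s ^ n) = 0" for n
        using c0[of n] by (simp add: c_def g_def mult.assoc)
    qed
    moreover have "t \<noteq> 0" using S(2) t by auto
    ultimately show ?thesis by simp
  qed
  have "inj_on T ?I"
  proof (rule inj_onI, rule ccontr)
    fix s t assume st: "s \<in> ?I" "t \<in> ?I" "T s = T t" "s \<noteq> t"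
    have "(1::'k) = 0"
      using zero[of "{s, t}" "\<lambda>r. if r = s then 1 else - 1" s] st by simp
    then show False by simp
  qed
  moreover have "independent (T ` ?I)"
    unfolding independent_explicit_finite_subsets
  proof (intro allI impI ballI)
    fix A u v assume A: "A \<subseteq> T ` ?I" "finite A" "(\<Sum>v\<in>A. u v \<odot> v) = 0" "v \<in> A"
    obtain S where S: "S \<subseteq> ?I" "finite S" "A = T ` S"
      using finite_subset_image[OF A(2,1)] by blast
    have "inj_on T S" using \<open>inj_on T ?I\<close> S(1) inj_on_subset by blast
    then have "(\<Sum>t\<in>S. u (T t) \<odot> T t) = 0" using A(3) unfolding S(3) by (simp add: sum.reindex)
    then show "u v = 0" using zero[OF S(2,1), of "\<lambda>t. u (T t)"] A(4) S(3) by auto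
  qed
  moreover have "T ` ?I \<subseteq> F" using F T by blast
  moreover have "?I \<approx> (UNIV :: real set)" by (simp add: open_interval_eqpoll_reals)
  ultimately show ?thesis
    using that[of "T ` ?I"] by (simp add: inj_on_image_eqpoll_1)
qed

text \<open>A continuum of independent vectors in \<open>G\<close> extends to a basis of
  \<open>G\<close>, whose size is bounded above by that of \<open>G\<close> itself.\<close>

lemma hamel_dim_continuum:
  fixes y :: "nat \<Rightarrow> 'e"
  assumes G: "subspace G" "qclosed G" and y: "range y \<subseteq> G" "\<And>n. y n \<notin> span (y ` {..<n})"
    and le: "G \<lesssim> (UNIV :: real set)"
  shows "has_hamel_dim scale G (UNIV :: real set)"
proof -
  obtain x where x: "c0_independent_mod {0} x" "\<And>c l. qlim (\<lambda>N. \<Sum>n<N. c n \<odot> x n) l \<Longrightarrow> l \<in> G"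
    using c0_independent_in_closed_subspace[OF G y] by metis
  obtain C where C: "independent C" "C \<subseteq> G" "C \<approx> (UNIV :: real set)"
    by (rule ex_independent_continuum[OF x])
  obtain B where B: "C \<subseteq> B" "B \<subseteq> G" "independent B" "G \<subseteq> span B"
    using maximal_independent_subset_extend[OF C(2,1)] by blast
  have "span B = G" using B G(1) span_minimal by blast
  moreover have "B \<approx> (UNIV :: real set)"
  proof (rule lepoll_antisym)
    show "B \<lesssim> (UNIV :: real set)" using B(2) le subset_imp_lepoll lepoll_trans by blast
    show "(UNIV :: real set) \<lesssim> B"
      using lepoll_trans1[OF eqpoll_sym[OF C(3)] subset_imp_lepoll[OF B(1)]] .
  qed
  ultimately show ?thesis using B(3) unfolding has_hamel_dim_def by blast
qed

end

context weak_nbhd_base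
begin

text \<open>Adding \<open>B\<close> to \<open>W\<close> first is what makes the final sum work: if
  \<open>h + f\<close> lies in \<open>W\<close> with \<open>h\<close> in \<open>G0\<close> and
  \<open>f\<close> in \<open>span B\<close>, then \<open>h\<close> lies in the enlarged subspace, so
  \<open>h = 0\<close>, and \<open>f\<close> lies in both \<open>span B\<close> and
  \<open>W\<close>.\<close>

theorem ex_closed_extension_continuum:
  assumes K: "(UNIV :: 'k set) \<lesssim> (UNIV :: real set)"
    and W: "subspace W" "M \<subseteq> W" and x: "c0_independent_mod W x"
    and B: "finite B" "span B \<inter> W \<subseteq> {0}"
  obtains G where "subspace G" "qclosed G" "has_hamel_dim scale G (UNIV :: real set)"
    "span B \<subseteq> G" "G \<inter> W \<subseteq> {0}"
proof -
  let ?W = "span (W \<union> B)"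
  have WW: "W \<subseteq> ?W" "span B \<subseteq> ?W" by (auto intro: span_base span_mono[THEN subsetD])
  obtain x' where x': "c0_independent_mod ?W x'"
    using c0_independent_mod_finite[OF W(1) x B(1)] by blast
  obtain z :: "nat \<Rightarrow> 'e" where z: "\<And>n. z n \<notin> span (z ` {..<n})" "qcl (span (range z)) \<inter> ?W \<subseteq> {0}"
    using ex_closed_subspace_avoiding[OF subspace_span _ x'] W(2) WW(1) by blast
  define G0 where "G0 = qcl (span (range z))"
  have G0: "subspace G0" "qclosed G0"
    unfolding G0_def by (simp_all add: subspace_qcl qclosed_qcl)
  define G where "G = span (G0 \<union> B)"
  have G: "subspace G" "qclosed G"
    unfolding G_def by (simp_all add: qclosed_span_Un_finite[OF G0 B(1)])
  have "g = 0" if g: "g \<in> G" "g \<in> W" for g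
  proof -
    obtain h f where hf: "g = h + f" "h \<in> span G0" "f \<in> span B"
      using g(1) unfolding G_def span_Un by blast
    have "h \<in> G0" using hf(2) G0(1) by (simp add: span_eq_iff[THEN iffD2])
    moreover have "g - f \<in> ?W" using g(2) hf(3) WW by (intro span_diff) auto
    ultimately have "h = 0" using z(2) hf(1) unfolding G0_def by auto
    then show ?thesis using B(2) g(2) hf by auto
  qed
  then have "G \<inter> W \<subseteq> {0}" by blast
  moreover have "has_hamel_dim scale G (UNIV :: real set)"
  proof (rule hamel_dim_continuum[OF G _ z(1)])
    have "range z \<subseteq> G0" unfolding G0_def by (rule order_trans[OF span_superset subset_qcl])
    then show "range z \<subseteq> G" unfolding G_def using span_superset[of "G0 \<union> B"] by blast
    \<comment> \<open>The cardinality bound applies to closed spans of countable sets, so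
      \<open>G\<close> is placed inside one.\<close>
    have "G0 \<subseteq> qcl (span (range z \<union> B))"
      unfolding G0_def by (intro qcl_mono span_mono) simp
    moreover have "B \<subseteq> qcl (span (range z \<union> B))"
      using order_trans[OF span_superset subset_qcl, of "range z \<union> B"] by blast
    ultimately have "G \<subseteq> qcl (span (range z \<union> B))"
      unfolding G_def by (intro span_minimal subspace_qcl subspace_span) simp
    moreover have "qcl (span (range z \<union> B)) \<lesssim> (UNIV :: real set)"
      by (rule qcl_span_countable_lepoll[OF K]) (use B(1) in \<open>simp add: countable_finite\<close>)
    ultimately show "G \<lesssim> (UNIV :: real set)" using subset_imp_lepoll lepoll_trans by blast
  qed
  moreover have "span B \<subseteq> G" unfolding G_def by (intro span_mono) simp
  ultimately show ?thesis using that G by blast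
qed

end

section \<open>F-norms on F-spaces\<close>

locale fnormed_topology = fnormed_space scale q
  for scale :: "'k::{real_normed_field,heine_borel} \<Rightarrow> 'e::ab_group_add \<Rightarrow> 'e" (infixr "\<odot>" 75)
    and q :: "'e \<Rightarrow> real" +
  fixes X :: "'e topology"
  assumes openin_iff: "openin X U \<longleftrightarrow> (\<forall>x\<in>U. \<exists>r>0. \<forall>y. q (y - x) < r \<longrightarrow> y \<in> U)"
begin

lemma topspace_X [simp]: "topspace X = UNIV"
proof -
  have "openin X UNIV" unfolding openin_iff by (intro ballI exI[of _ 1]) simp
  then show ?thesis using openin_subset by blast
qed

lemma openin_ball: "openin X {y. q (y - x) < r}"
  unfolding openin_iff
proof (intro ballI)
  fix y assume y: "y \<in> {y. q (y - x) < r}"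
  have "q (z - x) < r" if "q (z - y) < r - q (y - x)" for z
    using q_diff_triangle[of z x y] that by linarith
  then show "\<exists>s>0. \<forall>z. q (z - y) < s \<longrightarrow> z \<in> {y. q (y - x) < r}"
    using y by (intro exI[of _ "r - q (y - x)"]) auto
qed

lemma limitin_iff: "limitin X s l sequentially \<longleftrightarrow> qlim s l"
proof
  assume L: "limitin X s l sequentially"
  show "qlim s l"
    unfolding qlim_iff
  proof (intro allI impI)
    fix e :: real assume "0 < e"
    then have "l \<in> {y. q (y - l) < e}" by simp
    then have "eventually (\<lambda>n. s n \<in> {y. q (y - l) < e}) sequentially"
      using L openin_ball unfolding limitin_def by blast
    then show "\<exists>N. \<forall>n\<ge>N. q (s n - l) < e" by (simp add: eventually_sequentially)
  qed
next
  assume L: "qlim s l"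
  show "limitin X s l sequentially"
    unfolding limitin_def
  proof (intro conjI allI impI)
    fix U assume "openin X U \<and> l \<in> U"
    then obtain r where "r > 0" "\<And>y. q (y - l) < r \<Longrightarrow> y \<in> U" unfolding openin_iff by blast
    then show "eventually (\<lambda>n. s n \<in> U) sequentially"
      using L unfolding qlim_iff eventually_sequentially by meson
  qed simp
qed

lemma closedin_iff: "closedin X S \<longleftrightarrow> qclosed S"
proof -
  have "openin X (UNIV - S) \<longleftrightarrow> (\<forall>x. x \<notin> S \<longrightarrow> (\<exists>r>0. \<forall>y. q (y - x) < r \<longrightarrow> y \<notin> S))"
    unfolding openin_iff by blast
  also have "\<dots> \<longleftrightarrow> (\<forall>x. x \<notin> S \<longrightarrow> x \<notin> qcl S)"
    unfolding qcl_def using q_diff_commute by (simp add: not_less) (metis not_less)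
  also have "\<dots> \<longleftrightarrow> qclosed S" unfolding qclosed_def by blast
  finally show ?thesis by (simp add: closedin_def)
qed

lemma closed_subspace_iff: "closed_subspace scale X F \<longleftrightarrow> subspace F \<and> qclosed F"
  by (simp add: closed_subspace_def closedin_iff)

lemma series_converges_to_iff:
  "series_converges_to scale X c u l \<longleftrightarrow> qlim (\<lambda>N. \<Sum>n<N. c n \<odot> u n) l"
  by (simp add: series_converges_to_def limitin_iff)

text \<open>The base consists of the balanced neighbourhoods of zero of the weaker topology
  \<open>Y\<close>. If each ball of \<open>q\<close> contained one of them, translation would make
  every set open in the subspace topology open in \<open>Y\<close>, so that \<open>Y\<close> would
  not be strictly weaker.\<close>

lemma nonminimal_imp_weak_nbhd_base:
  assumes M: "subspace M" "qclosed M" and nonmin: "\<not> minimal_tvs scale (subtopology X M)"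
  obtains \<N> where "weak_nbhd_base scale q M \<N>"
proof -
  obtain Y where Y: "topspace Y = M" "tvs scale Y" "Hausdorff_space Y"
    "\<And>U. openin Y U \<Longrightarrow> openin (subtopology X M) U" "Y \<noteq> subtopology X M"
    using nonmin unfolding minimal_tvs_def by auto
  have add: "continuous_map (prod_topology Y Y) Y (\<lambda>(x, y). x + y)"
    and mult: "continuous_map (prod_topology euclidean Y) Y (\<lambda>(a, x). a \<odot> x)"
    using Y(2) unfolding tvs_def by auto
  have translate: "openin Y {y \<in> M. y - x \<in> U}" if "openin Y U" "x \<in> M" for U x
  proof -
    have "continuous_map Y (prod_topology Y Y) (\<lambda>y. (y, - x))"
      using subspace_neg[OF M(1) that(2)] Y(1)
      by (simp add: continuous_map_paired)
    then have "continuous_map Y Y ((\<lambda>(x, y). x + y) \<circ> (\<lambda>y. (y, - x)))"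
      by (rule continuous_map_compose[OF _ add])
    then have "continuous_map Y Y (\<lambda>y. y - x)" by (simp add: o_def)
    from openin_continuous_map_preimage[OF this that(1)] show ?thesis by (simp add: Y(1))
  qed
  have scale: "openin Y {y \<in> M. a \<odot> y \<in> U}" if "openin Y U" for U a
  proof -
    have "continuous_map Y (prod_topology euclidean Y) (\<lambda>y. (a, y))"
      by (simp add: continuous_map_paired)
    then have "continuous_map Y Y ((\<lambda>(a, x). a \<odot> x) \<circ> (\<lambda>y. (a, y)))"
      by (rule continuous_map_compose[OF _ mult])
    then have "continuous_map Y Y (\<lambda>y. a \<odot> y)" by (simp add: o_def)
    from openin_continuous_map_preimage[OF this that] show ?thesis by (simp add: Y(1))
  qed
  have M0: "0 \<in> M" by (rule subspace_0[OF M(1)])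
  \<comment> \<open>Asking for neighbourhoods rather than open sets spares a proof that balanced
    cores are open.\<close>
  define \<N> where "\<N> = {Q. Q \<subseteq> M \<and> (\<exists>U. openin Y U \<and> 0 \<in> U \<and> U \<subseteq> Q) \<and>
    (\<forall>c t. norm c \<le> 1 \<longrightarrow> t \<in> Q \<longrightarrow> c \<odot> t \<in> Q)}"
  have core: "\<exists>Q\<in>\<N>. Q \<subseteq> U" if U: "openin Y U" "0 \<in> U" for U
  proof -
    \<comment> \<open>The balanced core of \<open>U\<close>. Continuity of multiplication at the
      origin makes it a neighbourhood: \<open>c \<odot> y\<close> equals
      \<open>(c * s) \<odot> (inverse s \<odot> y)\<close>, and \<open>c * s\<close> stays in
      \<open>A\<close> for all \<open>c\<close> in the unit disc.\<close>
    define Q where "Q = {x \<in> M. \<forall>c. norm c \<le> 1 \<longrightarrow> c \<odot> x \<in> U}"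
    let ?P = "{p \<in> topspace (prod_topology euclidean Y). (\<lambda>(a, x). a \<odot> x) p \<in> U}"
    have "openin (prod_topology euclidean Y) ?P"
      by (rule openin_continuous_map_preimage[OF mult U(1)])
    moreover have "((0::'k), 0) \<in> ?P" using U(2) M0 Y(1) by simp
    ultimately obtain A O' where A: "openin euclidean A" "openin Y O'" "(0::'k) \<in> A" "0 \<in> O'"
      "A \<times> O' \<subseteq> ?P"
      unfolding openin_prod_topology_alt by meson
    obtain r where r: "r > 0" "\<And>c::'k. norm c < r \<Longrightarrow> c \<in> A"
      using A(1,3) unfolding open_openin[symmetric] open_dist by (metis dist_norm diff_zero)
    define s where "s = (of_real (r / 2) :: 'k)"
    have s: "s \<noteq> 0" "norm s = r / 2" using r(1) by (auto simp: s_def)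
    let ?O = "{y \<in> M. inverse s \<odot> y \<in> O'}"
    have "?O \<subseteq> Q"
    proof
      fix y assume y: "y \<in> ?O"
      have "c \<odot> y \<in> U" if "norm c \<le> 1" for c
      proof -
        have "norm (c * s) \<le> 1 * norm s" unfolding norm_mult using that by (intro mult_right_mono) auto
        also have "\<dots> < r" using s(2) r(1) by simp
        finally have "(c * s, inverse s \<odot> y) \<in> ?P" using r(2) y A(5) by blast
        then show ?thesis using s(1) by (simp add: mult.assoc)
      qed
      then show "y \<in> Q" using y by (simp add: Q_def)
    qed
    moreover have "openin Y ?O" by (rule scale[OF A(2)])
    moreover have "0 \<in> ?O" using M0 A(4) by simp
    moreover have "c \<odot> t \<in> Q" if "norm c \<le> 1" "t \<in> Q" for c t
    proof -
      have "norm (b * c) \<le> 1" if "norm b \<le> 1" for b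
        using \<open>norm c \<le> 1\<close> that by (simp add: norm_mult mult_le_one)
      then show ?thesis using that(2) subspace_scale[OF M(1)] by (auto simp: Q_def)
    qed
    moreover have "Q \<subseteq> M" by (auto simp: Q_def)
    ultimately have "Q \<in> \<N>" unfolding \<N>_def by blast
    moreover have "Q \<subseteq> U"
    proof
      fix x assume "x \<in> Q"
      then have "1 \<odot> x \<in> U" unfolding Q_def by (metis (mono_tags, lifting) mem_Collect_eq norm_one order_refl)
      then show "x \<in> U" by simp
    qed
    ultimately show ?thesis by blast
  qed
  have N: "Q \<subseteq> M" "\<exists>U. openin Y U \<and> 0 \<in> U \<and> U \<subseteq> Q" "\<And>c t. \<lbrakk>norm c \<le> 1; t \<in> Q\<rbrakk> \<Longrightarrow> c \<odot> t \<in> Q"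
    if "Q \<in> \<N>" for Q
    using that unfolding \<N>_def by auto
  have "weak_nbhd_base scale q M \<N>"
  proof (unfold_locales)
    show "subspace M" "qclosed M" by (fact M)+
    have "openin Y M" using Y(1) openin_topspace[of Y] by simp
    then show "\<N> \<noteq> {}" using core M0 by blast
    fix Q assume Q: "Q \<in> \<N>"
    show "Q \<subseteq> M" "\<And>c t. \<lbrakk>norm c \<le> 1; t \<in> Q\<rbrakk> \<Longrightarrow> c \<odot> t \<in> Q" using N[OF Q] by auto
    obtain U where U: "openin Y U" "0 \<in> U" "U \<subseteq> Q" using N(2)[OF Q] by blast
    then show "0 \<in> Q" by blast
    show "\<exists>P\<in>\<N>. \<forall>s\<in>P. \<forall>t\<in>P. s + t \<in> Q"
    proof -
      let ?P = "{p \<in> topspace (prod_topology Y Y). (\<lambda>(x, y). x + y) p \<in> U}"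
      have "openin (prod_topology Y Y) ?P"
        by (rule openin_continuous_map_preimage[OF add U(1)])
      moreover have "(0, 0) \<in> ?P" using U(2) M0 Y(1) by simp
      ultimately obtain A B where AB: "openin Y A" "openin Y B" "0 \<in> A" "0 \<in> B" "A \<times> B \<subseteq> ?P"
        unfolding openin_prod_topology_alt by meson
      obtain P where P: "P \<in> \<N>" "P \<subseteq> A \<inter> B" using core[OF openin_Int[OF AB(1,2)]] AB(3,4) by blast
      have "s + t \<in> Q" if "s \<in> P" "t \<in> P" for s t
      proof -
        have "(s, t) \<in> ?P" using that P(2) AB(5) by blast
        then show ?thesis using U(3) by auto
      qed
      then show ?thesis using P(1) by blast
    qed
    show "\<exists>r>0. \<forall>u\<in>M. q u < r \<longrightarrow> u \<in> Q"
    proof -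
      obtain T where T: "openin X T" "U = T \<inter> M"
        using Y(4)[OF U(1)] unfolding openin_subtopology by blast
      then obtain r where "r > 0" "\<And>y. q (y - 0) < r \<Longrightarrow> y \<in> T"
        using U(2) unfolding openin_iff by blast
      then show ?thesis using T(2) U(3) by auto
    qed
  next
    fix P Q assume "P \<in> \<N>" "Q \<in> \<N>"
    then obtain U U' where "openin Y U" "0 \<in> U" "U \<subseteq> P" "openin Y U'" "0 \<in> U'" "U' \<subseteq> Q"
      using N(2) by meson
    then show "\<exists>R\<in>\<N>. R \<subseteq> P \<inter> Q" using core[of "U \<inter> U'"] by blast
  next
    fix x assume "x \<in> M" "x \<noteq> 0"
    then obtain U where "openin Y U" "0 \<in> U" "x \<notin> U"
      using Y(3) M0 unfolding Hausdorff_space_def Y(1) disjnt_def by blast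
    then show "\<exists>Q\<in>\<N>. x \<notin> Q" using core by blast
  next
    show "\<exists>r>0. \<forall>Q\<in>\<N>. \<not> Q \<subseteq> {u. q u < r}"
    proof (rule ccontr)
      assume "\<not> ?thesis"
      then have small: "\<exists>Q\<in>\<N>. Q \<subseteq> {u. q u < r}" if "0 < r" for r using that by blast
      have "openin Y S" if S: "openin (subtopology X M) S" for S
      proof -
        obtain T where T: "openin X T" "S = T \<inter> M"
          using S unfolding openin_subtopology by blast
        show ?thesis
        proof (subst openin_subopen, intro ballI)
          fix x assume x: "x \<in> S"
          then obtain r where r: "r > 0" "\<And>y. q (y - x) < r \<Longrightarrow> y \<in> T"
            using T unfolding openin_iff by blast
          obtain Q where Q: "Q \<in> \<N>" "Q \<subseteq> {u. q u < r}" using small[OF r(1)] by blast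
          obtain U where U: "openin Y U" "0 \<in> U" "U \<subseteq> Q" using N(2)[OF Q(1)] by blast
          have xM: "x \<in> M" using x T(2) by blast
          have "{y \<in> M. y - x \<in> U} \<subseteq> S" using U(3) Q(2) r(2) T(2) by blast
          moreover have "x \<in> {y \<in> M. y - x \<in> U}" using xM U(2) by simp
          ultimately show "\<exists>V. openin Y V \<and> x \<in> V \<and> V \<subseteq> S"
            using translate[OF U(1) xM] by blast
        qed
      qed
      then have "Y = subtopology X M" unfolding topology_eq using Y(4) by blast
      then show False using Y(5) by blast
    qed
  qed
  then show ?thesis using that by blast
qed

end

text \<open>An invariant metric may grow under scalars of modulus at most one. Taking the supremum
  over the unit disc repairs this, truncation at 1 keeps the supremum finite, and joint continuity
  of multiplication shows that the balls of \<open>q\<close> and \<open>d\<close> at zero define the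
  same topology.\<close>

lemma F_space_imp_fnormed_topology:
  fixes smul :: "'k::{real_normed_field,heine_borel} \<Rightarrow> 'e::ab_group_add \<Rightarrow> 'e"
  assumes "F_space smul X"
  obtains q where "fnormed_topology smul q X"
proof -
  obtain d where tvs: "tvs smul X" and top: "topspace X = UNIV" and d: "Metric_space UNIV d"
    and X: "Metric_space.mtopology UNIV d = X" and complete: "Metric_space.mcomplete UNIV d"
    and trans: "\<And>x y z. d (x + z) (y + z) = d x y"
    using assms unfolding F_space_def by blast
  interpret vector_space smul using tvs by (simp add: tvs_def)
  interpret d: Metric_space UNIV d by (rule d)
  have mult: "continuous_map (prod_topology euclidean X) X (\<lambda>(a, x). smul a x)"
    using tvs by (simp add: tvs_def)
  have opX: "openin X U \<longleftrightarrow> (\<forall>x\<in>U. \<exists>r>0. \<forall>y. d y x < r \<longrightarrow> y \<in> U)" for U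
    unfolding X[symmetric] d.openin_mtopology by (simp add: d.mball_def subset_iff d.commute Ball_def)
  have dsub: "d x y = d (x - y) 0" for x y using trans[of x "- y" y] by simp
  define m where "m v = min 1 (d v 0)" for v
  have m: "0 \<le> m v" "m v \<le> 1" for v by (simp_all add: m_def)
  have m_add: "m (x + y) \<le> m x + m y" for x y
  proof -
    have "d (x + y) 0 \<le> d (x + y) y + d y 0" by (rule d.triangle) auto
    also have "d (x + y) y = d x 0" using trans[of x y 0] by simp
    finally show ?thesis unfolding m_def by (simp add: min_def) (use d.nonneg[of x 0] d.nonneg[of y 0] in linarith)
  qed
  define q where "q v = (SUP c\<in>cball (0::'k) 1. m (smul c v))" for v
  have bdd: "bdd_above ((\<lambda>c. m (smul c v)) ` A)" for v and A :: "'k set"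
    using m(2) by (meson bdd_aboveI2)
  have m_le: "m (smul c v) \<le> q v" if "norm c \<le> 1" for c v
    unfolding q_def by (rule cSUP_upper[OF _ bdd]) (use that in simp)
  have q_le: "q v \<le> e" if "\<And>c. norm c \<le> 1 \<Longrightarrow> m (smul c v) \<le> e" for v e
    unfolding q_def by (rule cSUP_least) (use that in auto)
  have m_le1: "m v \<le> q v" for v using m_le[of 1 v] by simp
  have ball: "\<exists>r>0. \<forall>v. d v 0 < r \<longrightarrow> q v < e" if e: "0 < e" for e
  proof -
    define U where "U = {v. d v 0 < e / 2}"
    have "openin X U"
      unfolding U_def X[symmetric] using d.openin_mball[of 0 "e / 2"] by (simp add: d.mball_def d.commute)
    let ?P = "{p \<in> topspace (prod_topology euclidean X). (\<lambda>(a, x). smul a x) p \<in> U}"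
    have "openin (prod_topology euclidean X) ?P"
      by (rule openin_continuous_map_preimage[OF mult \<open>openin X U\<close>])
    moreover have "((0::'k), 0) \<in> ?P" using e top by (simp add: U_def)
    ultimately obtain A B where AB: "openin euclidean A" "openin X B" "(0::'k) \<in> A" "0 \<in> B" "A \<times> B \<subseteq> ?P"
      unfolding openin_prod_topology_alt by meson
    obtain r where r: "r > 0" "\<And>c::'k. norm c < r \<Longrightarrow> c \<in> A"
      using AB(1,3) unfolding open_openin[symmetric] open_dist by (metis dist_norm diff_zero)
    define s where "s = (of_real (r / 2) :: 'k)"
    have s: "s \<noteq> 0" "norm s = r / 2" using r(1) by (auto simp: s_def)
    have "continuous_map X (prod_topology euclidean X) (\<lambda>y. (inverse s, y))"
      by (simp add: continuous_map_paired)
    then have "continuous_map X X ((\<lambda>(a, x). smul a x) \<circ> (\<lambda>y. (inverse s, y)))"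
      by (rule continuous_map_compose[OF _ mult])
    then have "continuous_map X X (\<lambda>y. smul (inverse s) y)" by (simp add: o_def)
    from openin_continuous_map_preimage[OF this AB(2)]
    have "openin X {y. smul (inverse s) y \<in> B}" by (simp add: top)
    moreover have "0 \<in> {y. smul (inverse s) y \<in> B}" using AB(4) by simp
    ultimately have "\<exists>t>0. \<forall>y. d y 0 < t \<longrightarrow> y \<in> {y. smul (inverse s) y \<in> B}"
      unfolding opX by (rule bspec)
    then obtain t where t: "t > 0" "\<And>y. d y 0 < t \<Longrightarrow> smul (inverse s) y \<in> B" by auto
    have "q v < e" if v: "d v 0 < t" for v
    proof -
      have "q v \<le> e / 2"
      proof (rule q_le)
        fix c :: 'k assume "norm c \<le> 1"
        then have "norm (c * s) \<le> 1 * norm s" unfolding norm_mult by (intro mult_right_mono) auto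
        also have "\<dots> < r" using s(2) r(1) by simp
        finally have "(c * s, smul (inverse s) v) \<in> ?P" using r(2) t(2)[OF v] AB(5) by blast
        then have "smul c v \<in> U" using s(1) by (simp add: mult.assoc)
        then show "m (smul c v) \<le> e / 2" by (simp add: U_def m_def)
      qed
      then show ?thesis using e by simp
    qed
    then show ?thesis using t(1) by blast
  qed
  \<comment> \<open>Below 1 the truncation in \<open>m\<close> is inactive, hence the minimum with
    1.\<close>
  have dq: "d v 0 < r" if "q v < min 1 r" for v r
    using m_le1[of v] that by (auto simp: m_def)
  have "fnormed_topology smul q X"
  proof (unfold_locales)
    show "q 0 = 0" by (simp add: q_def m_def)
    show "x = 0" if "q x = 0" for x
      using m_le1[of x] m(1)[of x] that by (simp add: m_def min_def split: if_splits)
    show "q (x + y) \<le> q x + q y" for x y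
    proof (rule q_le)
      fix c :: 'k assume c: "norm c \<le> 1"
      show "m (smul c (x + y)) \<le> q x + q y"
        using m_add[of "smul c x" "smul c y"] m_le[OF c, of x] m_le[OF c, of y]
        by (simp add: scale_right_distrib)
    qed
    show "q (smul c x) \<le> q x" if "norm c \<le> 1" for c x
    proof (rule q_le)
      fix b :: 'k assume "norm b \<le> 1"
      then have "norm (b * c) \<le> 1" using that by (simp add: norm_mult mult_le_one)
      from m_le[OF this, of x] show "m (smul b (smul c x)) \<le> q x" by simp
    qed
    show "\<exists>r>0. \<forall>c. norm c < r \<longrightarrow> q (smul c x) < e" if e: "0 < e" for e x
    proof -
      obtain r where r: "0 < r" "\<And>v. d v 0 < r \<Longrightarrow> q v < e" using ball[OF e] by blast
      have "continuous_map euclidean (prod_topology euclidean X) (\<lambda>a::'k. (a, x))"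
        using top by (simp add: continuous_map_paired)
      then have "continuous_map euclidean X ((\<lambda>(a, x). smul a x) \<circ> (\<lambda>a. (a, x)))"
        by (rule continuous_map_compose[OF _ mult])
      then have cont: "continuous_map euclidean X (\<lambda>a. smul a x)" by (simp add: o_def)
      have "openin X {v. d v 0 < r}"
        unfolding X[symmetric] using d.openin_mball[of 0 r] by (simp add: d.mball_def d.commute)
      from openin_continuous_map_preimage[OF cont this]
      have "open {a. d (smul a x) 0 < r}" by simp
      moreover have "0 \<in> {a. d (smul a x) 0 < r}" using r(1) by simp
      ultimately have "\<exists>s>0. \<forall>a. dist a 0 < s \<longrightarrow> a \<in> {a. d (smul a x) 0 < r}"
        unfolding open_dist by (rule bspec)
      then obtain s where "s > 0" "\<And>a. norm a < s \<Longrightarrow> d (smul a x) 0 < r" by auto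
      then show ?thesis using r(2) by blast
    qed
    show "\<exists>l. (\<lambda>n. q (s n - l)) \<longlonglongrightarrow> 0"
      if C: "\<And>e. 0 < e \<Longrightarrow> \<exists>N. \<forall>m\<ge>N. \<forall>n\<ge>N. q (s m - s n) < e" for s :: "nat \<Rightarrow> 'e"
    proof -
      have "d.MCauchy s"
        unfolding d.MCauchy_def
      proof (intro conjI allI impI)
        fix e :: real assume "0 < e"
        then obtain N where "\<And>m n. \<lbrakk>N \<le> m; N \<le> n\<rbrakk> \<Longrightarrow> q (s m - s n) < min 1 e"
          using C[of "min 1 e"] by auto
        then show "\<exists>N. \<forall>n n'. N \<le> n \<longrightarrow> N \<le> n' \<longrightarrow> d (s n) (s n') < e"
          using dq dsub by metis
      qed simp
      then obtain l where l: "limitin d.mtopology s l sequentially"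
        using complete unfolding d.mcomplete_def by blast
      have "\<exists>N. \<forall>n\<ge>N. norm (q (s n - l) - 0) < e" if e: "0 < e" for e
      proof -
        obtain r where r: "0 < r" "\<And>v. d v 0 < r \<Longrightarrow> q v < e" using ball[OF e] by blast
        obtain N where "\<And>n. n \<ge> N \<Longrightarrow> d (s n) l < r"
          using l r(1) unfolding d.limitin_metric eventually_sequentially by blast
        then have "q (s n - l) < e" if "n \<ge> N" for n using r(2) dsub that by metis
        moreover have "0 \<le> q v" for v using m_le1[of v] m(1)[of v] by linarith
        ultimately show ?thesis by (intro exI[of _ N]) simp
      qed
      then show ?thesis unfolding LIMSEQ_iff by blast
    qed
    show "openin X U \<longleftrightarrow> (\<forall>x\<in>U. \<exists>r>0. \<forall>y. q (y - x) < r \<longrightarrow> y \<in> U)" for U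
      unfolding opX
    proof (intro ball_cong refl iffI)
      fix x assume "\<exists>r>0. \<forall>y. d y x < r \<longrightarrow> y \<in> U"
      then obtain r where r: "r > 0" "\<And>y. d y x < r \<Longrightarrow> y \<in> U" by blast
      have "y \<in> U" if "q (y - x) < min 1 r" for y
        using r(2)[of y] dq[OF that] dsub[of y x] by simp
      then show "\<exists>r>0. \<forall>y. q (y - x) < r \<longrightarrow> y \<in> U"
        using r(1) by (intro exI[of _ "min 1 r"]) simp
    next
      fix x assume "\<exists>r>0. \<forall>y. q (y - x) < r \<longrightarrow> y \<in> U"
      then obtain r where r: "r > 0" "\<And>y. q (y - x) < r \<Longrightarrow> y \<in> U" by blast
      then show "\<exists>r>0. \<forall>y. d y x < r \<longrightarrow> y \<in> U" using ball[OF r(1)] dsub by metis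
    qed
  qed
  then show ?thesis using that by blast
qed

section \<open>The equivalences for both scalar fields\<close>

lemma module_seq_scale: "module seq_scale"
  by (unfold_locales; simp add: seq_scale_def fun_eq_iff algebra_simps)

lemma closed_subspace_c_null: "closed_subspace seq_scale (mtopology_of l_infty) (c_null :: (nat \<Rightarrow> 'k::real_normed_field) set)"
  unfolding closed_subspace_def
proof
  show "module.subspace seq_scale (c_null :: (nat \<Rightarrow> 'k) set)"
    unfolding module.subspace_def[OF module_seq_scale] c_null_def seq_scale_def plus_fun_def
    by (auto intro!: tendsto_eq_intros simp: zero_fun_def)
  have sub: "c_null \<subseteq> mspace (l_infty :: (nat \<Rightarrow> 'k) metric)"
    unfolding mspace_l_infty c_null_def using convergent_imp_bounded by auto
  show "closedin (mtopology_of l_infty) (c_null :: (nat \<Rightarrow> 'k) set)"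
    unfolding mtopology_of_def Metric_space.closedin_metric[OF Metric_space_mspace_mdist]
  proof (intro conjI allI impI)
    fix c :: "nat \<Rightarrow> 'k" assume c: "c \<in> mspace l_infty - c_null"
    then obtain e where e: "e > 0" "\<And>N. \<exists>n\<ge>N. norm (c n) \<ge> e"
      unfolding c_null_def LIMSEQ_iff by (auto simp: not_less)
    have "a \<notin> Metric_space.mball (mspace l_infty) (mdist l_infty) c (e / 2)"
      if a: "a \<in> c_null" for a
    proof
      assume "a \<in> Metric_space.mball (mspace l_infty) (mdist l_infty) c (e / 2)"
      then have "mdist l_infty c a < e / 2"
        by (simp add: Metric_space.in_mball[OF Metric_space_mspace_mdist])
      moreover have b: "bounded (range c)" "bounded (range a)"
        using c a sub unfolding mspace_l_infty by auto
      ultimately have lt: "(SUP n. norm (c n - a n)) < e / 2" by (simp add: mdist_l_infty)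
      obtain K where "\<And>n. norm (c n) \<le> K" "\<And>n. norm (a n) \<le> K"
        using b unfolding bounded_iff by (metis (no_types, lifting) linorder_linear order_trans rangeI)
      then have "bdd_above (range (\<lambda>n. norm (c n - a n)))"
        by (intro bdd_aboveI2[of _ _ "K + K"]) (meson add_mono norm_triangle_ineq4 order_trans)
      then have "norm (c n - a n) \<le> (SUP n. norm (c n - a n))" for n by (intro cSUP_upper) auto
      with lt have ca: "norm (c n - a n) < e / 2" for n by (meson le_less_trans)
      obtain N where N: "\<And>n. n \<ge> N \<Longrightarrow> norm (a n) < e / 2"
        using a half_gt_zero[OF e(1)] unfolding c_null_def LIMSEQ_iff diff_zero mem_Collect_eq by blast
      obtain n where "n \<ge> N" "norm (c n) \<ge> e" using e(2) by blast
      then show False using N[of n] ca[of n] norm_triangle_sub[of "c n" "a n"] by linarith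
    qed
    then show "\<exists>r>0. disjnt c_null (Metric_space.mball (mspace l_infty) (mdist l_infty) c r)"
      using e(1) by (intro exI[of _ "e / 2"]) (auto simp: disjnt_iff)
  qed (fact sub)
qed

text \<open>One argument serves both fields: the real and the complex numbers enter through the type
  classes and the cardinality bound \<open>K\<close>.\<close>

lemma spaceability_equivalences:
  fixes smul :: "'k::{real_normed_field,heine_borel} \<Rightarrow> 'e::ab_group_add \<Rightarrow> 'e"
  assumes K: "(UNIV :: 'k set) \<lesssim> (UNIV :: real set)"
    and F_space: "F_space smul X" and W: "module.subspace smul W"
    and nonmin: "\<exists>M. closed_subspace smul X M \<and> \<not> minimal_tvs smul (subtopology X M) \<and> M \<subseteq> W"
  defines "seq_cond \<equiv> \<exists>S x. closed_subspace seq_scale (mtopology_of l_infty) S \<and> c_null \<subseteq> S \<and>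
    S_independent smul X S x \<and> seq_lineable smul X x S (UNIV - W)"
  shows "(spaceable smul X (UNIV - W) \<longleftrightarrow> seq_cond) \<and>
    (seq_cond \<longleftrightarrow> (\<forall>n::nat. n \<ge> 1 \<longrightarrow> pair_spaceable smul X {..<n} (UNIV :: real set) (UNIV - W)))"
proof -
  obtain q where "fnormed_topology smul q X" by (rule F_space_imp_fnormed_topology[OF F_space])
  then interpret fnormed_topology smul q X .
  note W0 = subspace_0[OF W]
  have avoid: "F \<subseteq> (UNIV - W) \<union> {0} \<longleftrightarrow> F \<inter> W \<subseteq> {0}" for F by blast
  have seq_cond_iff: "seq_cond \<longleftrightarrow> (\<exists>x. c0_independent_mod W x)"
  proof
    assume seq_cond
    then obtain S x where S: "c_null \<subseteq> S" "S_independent smul X S x" "seq_lineable smul X x S (UNIV - W)"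
      unfolding seq_cond_def by blast
    have "\<exists>l. qlim (\<lambda>N. \<Sum>n<N. smul (c n) (x n)) l \<and> (l \<in> W \<longrightarrow> (\<forall>n. c n = 0))"
      if c: "c \<in> c_null" for c
    proof -
      have cS: "c \<in> S" using c S(1) by blast
      then obtain l where l: "l \<in> (UNIV - W) \<union> {0}" "series_converges_to smul X c x l"
        using S(3) unfolding seq_lineable_def by blast
      have "\<forall>n. c n = 0" if "l \<in> W"
        using l that S(2) cS unfolding S_independent_def by auto
      then show ?thesis using l(2) unfolding series_converges_to_iff by blast
    qed
    then show "\<exists>x. c0_independent_mod W x" unfolding c0_independent_mod_def by blast
  next
    assume "\<exists>x. c0_independent_mod W x"
    then obtain x where x: "c0_independent_mod W x" by blast
    have "S_independent smul X c_null x"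
      unfolding S_independent_def series_converges_to_iff
    proof (intro ballI impI)
      fix c :: "nat \<Rightarrow> 'k" assume c: "c \<in> c_null" "qlim (\<lambda>N. \<Sum>n<N. smul (c n) (x n)) 0"
      obtain l where "qlim (\<lambda>N. \<Sum>n<N. smul (c n) (x n)) l" "l \<in> W \<longrightarrow> (\<forall>n. c n = 0)"
        using bspec[OF x[unfolded c0_independent_mod_def] c(1)] by blast
      then show "\<forall>n. c n = 0" using qlim_unique[OF c(2)] W0 by blast
    qed
    moreover have "seq_lineable smul X x c_null (UNIV - W)"
      unfolding seq_lineable_def series_converges_to_iff
    proof
      fix c :: "nat \<Rightarrow> 'k" assume c: "c \<in> c_null"
      obtain l where l: "qlim (\<lambda>N. \<Sum>n<N. smul (c n) (x n)) l" "l \<in> W \<longrightarrow> (\<forall>n. c n = 0)"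
        using bspec[OF x[unfolded c0_independent_mod_def] c] by blast
      have "l = 0" if "l \<in> W"
      proof -
        have "qlim (\<lambda>N. 0) l" using l that by simp
        then show ?thesis using qlim_unique[OF _ qlim_const[of 0]] by simp
      qed
      then show "\<exists>l\<in>UNIV - W \<union> {0}. qlim (\<lambda>N. \<Sum>n<N. smul (c n) (x n)) l"
        using l(1) by (intro bexI[of _ l]) auto
    qed
    ultimately show seq_cond
      unfolding seq_cond_def using closed_subspace_c_null by blast
  qed
  have 1: "\<exists>x. c0_independent_mod W x" if sp: "spaceable smul X (UNIV - W)"
  proof -
    obtain F B where F: "subspace F" "qclosed F" "F \<inter> W \<subseteq> {0}"
      and B: "independent B" "span B = F" "infinite B"
      using sp unfolding spaceable_def closed_subspace_iff infinite_dimensional_def avoid by blast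
    obtain y :: "nat \<Rightarrow> 'e" where y: "range y \<subseteq> B" "\<And>n. y n \<notin> span (y ` {..<n})"
      using infinite_independent_sequence[OF B(1,3)] by blast
    have "range y \<subseteq> F" using y(1) B(2) span_superset by blast
    then obtain x where x: "c0_independent_mod {0} x"
      "\<And>c l. qlim (\<lambda>N. \<Sum>n<N. smul (c n) (x n)) l \<Longrightarrow> l \<in> F"
      using c0_independent_in_closed_subspace[OF F(1,2) _ y(2)] by metis
    have "c0_independent_mod W x"
      unfolding c0_independent_mod_def
    proof
      fix c :: "nat \<Rightarrow> 'k" assume c: "c \<in> c_null"
      obtain l where l: "qlim (\<lambda>N. \<Sum>n<N. smul (c n) (x n)) l" "l \<in> {0} \<longrightarrow> (\<forall>n. c n = 0)"
        using bspec[OF x(1)[unfolded c0_independent_mod_def] c] by blast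
      then show "\<exists>l. qlim (\<lambda>N. \<Sum>n<N. smul (c n) (x n)) l \<and> (l \<in> W \<longrightarrow> (\<forall>n. c n = 0))"
        using x(2)[OF l(1)] F(3) by (intro exI[of _ l]) blast
    qed
    then show ?thesis by blast
  qed
  have 2: "pair_spaceable smul X {..<n} (UNIV :: real set) (UNIV - W)"
    if x: "c0_independent_mod W x" for x and n :: nat
    unfolding pair_spaceable_def
  proof
    have comb: "\<forall>i<n. c i = 0" if "(\<Sum>i<n. smul (c i) (x i)) \<in> W" for c
    proof -
      \<comment> \<open>Extended by zeros, a finite combination becomes a series with null
        coefficients, so independence modulo \<open>W\<close> covers it.\<close>
      define b where "b i = (if i < n then c i else 0)" for i
      have b: "b \<in> c_null" by (rule c_null_finite_support[of n]) (simp add: b_def)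
      obtain l where l: "qlim (\<lambda>N. \<Sum>i<N. smul (b i) (x i)) l" "l \<in> W \<longrightarrow> (\<forall>n. b n = 0)"
        using bspec[OF x[unfolded c0_independent_mod_def] b] by blast
      have "(\<Sum>i<N. smul (b i) (x i)) = (\<Sum>i<n. smul (c i) (x i))" if "N \<ge> n" for N
        by (rule sum.mono_neutral_cong_right) (use that in \<open>auto simp: b_def\<close>)
      then have "qlim (\<lambda>N. \<Sum>i<N. smul (b i) (x i)) (\<Sum>i<n. smul (c i) (x i))"
        unfolding qlim_iff by (metis diff_self q_zero)
      then have "l \<in> W" using qlim_unique[OF l(1)] that by simp
      then show ?thesis using l(2) unfolding b_def by metis
    qed
    have inj: "inj_on x {..<n}"
    proof (rule inj_onI, rule ccontr)
      fix i j assume ij: "i \<in> {..<n}" "j \<in> {..<n}" "x i = x j" "i \<noteq> j"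
      define c where "c k = (if k = i then 1 else if k = j then - 1 else 0 :: 'k)" for k
      have "(\<Sum>k<n. smul (c k) (x k)) = (\<Sum>k\<in>{i, j}. smul (c k) (x k))"
        by (rule sum.mono_neutral_right) (use ij in \<open>auto simp: c_def\<close>)
      also have "\<dots> = 0" using ij by (simp add: c_def)
      finally have "\<forall>k<n. c k = 0" using comb[of c] W0 by simp
      then have "c i = 0" using ij(1) by simp
      then show False by (simp add: c_def)
    qed
    have comb': "\<forall>v\<in>x ` {..<n}. c v = 0" if "(\<Sum>v\<in>x ` {..<n}. smul (c v) v) \<in> W" for c
    proof -
      have "(\<Sum>i<n. smul (c (x i)) (x i)) \<in> W" using that by (simp add: sum.reindex[OF inj])
      from comb[OF this] show ?thesis by simp
    qed
    have "independent (x ` {..<n})"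
      using comb' W0 by (auto simp: dependent_finite)
    moreover have "x ` {..<n} \<approx> {..<n}" by (simp add: inj inj_on_image_eqpoll_1)
    moreover have "span (x ` {..<n}) - {0} \<subseteq> UNIV - W"
    proof -
      have "v = 0" if v: "v \<in> span (x ` {..<n})" "v \<in> W" for v
      proof -
        obtain c where c: "v = (\<Sum>v\<in>x ` {..<n}. smul (c v) v)"
          using v(1) by (auto simp: span_finite)
        then have "\<forall>v\<in>x ` {..<n}. c v = 0" using comb'[of c] v(2) by simp
        then show ?thesis unfolding c by (intro sum.neutral) auto
      qed
      then show ?thesis by blast
    qed
    ultimately show "lineable smul {..<n} (UNIV - W)"
      unfolding lineable_def has_hamel_dim_def using subspace_span by blast
  next
    obtain M where sub: "subspace M" "qclosed M" "\<not> minimal_tvs smul (subtopology X M)"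
      and MW: "M \<subseteq> W"
      using nonmin unfolding closed_subspace_iff by blast
    obtain \<N> where "weak_nbhd_base smul q M \<N>" by (rule nonminimal_imp_weak_nbhd_base[OF sub])
    then interpret weak_nbhd_base smul q M \<N> .
    show "\<forall>F. subspace F \<and> F \<subseteq> UNIV - W \<union> {0} \<and> has_hamel_dim smul F {..<n} \<longrightarrow>
      (\<exists>G. closed_subspace smul X G \<and> has_hamel_dim smul G (UNIV :: real set) \<and> F \<subseteq> G \<and>
        G \<subseteq> UNIV - W \<union> {0})"
      unfolding avoid closed_subspace_iff
    proof (intro allI impI, elim conjE)
      fix F assume F: "F \<inter> W \<subseteq> {0}" "has_hamel_dim smul F {..<n}"
      obtain B where B: "span B = F" "B \<approx> {..<n}"
        using F(2) unfolding has_hamel_dim_def by blast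
      have finB: "finite B" using B(2) eqpoll_finite_iff by blast
      have "span B \<inter> W \<subseteq> {0}" using F(1) B(1) by simp
      then obtain G where "subspace G" "qclosed G" "has_hamel_dim smul G (UNIV :: real set)"
        "span B \<subseteq> G" "G \<inter> W \<subseteq> {0}"
        by (rule ex_closed_extension_continuum[OF K W MW x finB])
      then show "\<exists>G. (subspace G \<and> qclosed G) \<and> has_hamel_dim smul G (UNIV :: real set) \<and> F \<subseteq> G \<and> G \<inter> W \<subseteq> {0}"
        using B(1) by blast
    qed
  qed
  have 3: "spaceable smul X (UNIV - W)"
    if "\<forall>n::nat. n \<ge> 1 \<longrightarrow> pair_spaceable smul X {..<n} (UNIV :: real set) (UNIV - W)"
  proof -
    have ps: "pair_spaceable smul X {..<1::nat} (UNIV :: real set) (UNIV - W)" using that by blast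
    then have "lineable smul {..<1::nat} (UNIV - W)" by (simp add: pair_spaceable_def)
    then obtain F where F: "subspace F" "has_hamel_dim smul F {..<1::nat}" "F - {0} \<subseteq> UNIV - W"
      unfolding lineable_def by (elim exE conjE)
    have FA: "F \<subseteq> (UNIV - W) \<union> {0}" using F(3) by blast
    from ps[unfolded pair_spaceable_def, THEN conjunct2, rule_format, OF conjI[OF F(1) conjI[OF FA F(2)]]]
    obtain G where G: "closed_subspace smul X G" "has_hamel_dim smul G (UNIV :: real set)"
      "G \<subseteq> (UNIV - W) \<union> {0}"
      by (elim exE conjE) (rule that)
    obtain B where B: "independent B" "span B = G" "B \<approx> (UNIV :: real set)"
      using G(2) unfolding has_hamel_dim_def by blast
    have "infinite B" using eqpoll_finite_iff[OF B(3)] infinite_UNIV_char_0 by blast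
    then show ?thesis
      unfolding spaceable_def infinite_dimensional_def using G(1,3) B(1,2) by blast
  qed
  show ?thesis unfolding seq_cond_iff using 1 2 3 by blast
qed

text \<open>The coding of sequences is reused: a complex number is stored in a constant sequence
  whose coefficients are its real and imaginary parts.\<close>

lemma complex_lepoll_real: "(UNIV :: complex set) \<lesssim> (UNIV :: real set)"
proof -
  define f :: "complex \<Rightarrow> nat \<Rightarrow> (nat \<Rightarrow> real) \<times> nat" where
    "f z = (\<lambda>_. (\<lambda>i. if i = 0 then Re z else Im z, 0))" for z
  have "inj f"
    by (rule inj_on_inverseI[where g = "\<lambda>p. Complex (fst (p 0) 0) (fst (p 0) 1)"]) (simp add: f_def)
  then have "(UNIV :: complex set) \<lesssim> (UNIV :: (nat \<Rightarrow> (nat \<Rightarrow> real) \<times> nat) set)"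
    unfolding lepoll_def by blast
  then show ?thesis using sequences_lepoll_real[where 'k = real] lepoll_trans by blast
qed

theorem corollary4p2:
  shows "(\<forall>(smul :: real \<Rightarrow> 'e::ab_group_add \<Rightarrow> 'e) (X :: 'e topology) (W :: 'e set).
        F_space smul X \<and> module.subspace smul W \<and>
        (\<exists>M. closed_subspace smul X M \<and> \<not> minimal_tvs smul (subtopology X M) \<and> M \<subseteq> W) \<longrightarrow>
        (spaceable smul X (UNIV - W) \<longleftrightarrow>
          (\<exists>S x. closed_subspace seq_scale (mtopology_of l_infty) S \<and> c_null \<subseteq> S \<and>
            S_independent smul X S x \<and> seq_lineable smul X x S (UNIV - W))) \<and>
        ((\<exists>S x. closed_subspace seq_scale (mtopology_of l_infty) S \<and> c_null \<subseteq> S \<and>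
            S_independent smul X S x \<and> seq_lineable smul X x S (UNIV - W)) \<longleftrightarrow>
          (\<forall>n::nat. n \<ge> 1 \<longrightarrow>
            pair_spaceable smul X {..<n} (UNIV :: real set) (UNIV - W)))) \<and>
    (\<forall>(smul :: complex \<Rightarrow> 'e::ab_group_add \<Rightarrow> 'e) (X :: 'e topology) (W :: 'e set).
        F_space smul X \<and> module.subspace smul W \<and>
        (\<exists>M. closed_subspace smul X M \<and> \<not> minimal_tvs smul (subtopology X M) \<and> M \<subseteq> W) \<longrightarrow>
        (spaceable smul X (UNIV - W) \<longleftrightarrow>
          (\<exists>S x. closed_subspace seq_scale (mtopology_of l_infty) S \<and> c_null \<subseteq> S \<and>
            S_independent smul X S x \<and> seq_lineable smul X x S (UNIV - W))) \<and>
        ((\<exists>S x. closed_subspace seq_scale (mtopology_of l_infty) S \<and> c_null \<subseteq> S \<and>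
            S_independent smul X S x \<and> seq_lineable smul X x S (UNIV - W)) \<longleftrightarrow>
          (\<forall>n::nat. n \<ge> 1 \<longrightarrow>
            pair_spaceable smul X {..<n} (UNIV :: real set) (UNIV - W))))"
  by (rule conjI; intro allI impI; elim conjE; rule spaceability_equivalences)
    (assumption | rule lepoll_refl complex_lepoll_real)+

end
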